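(* Satisfiability of GBSR sentences is decidable: there is an algorithm that, given a GBSR sentence $\varphi$, decides whether $\varphi$ has a model.
   Context: A first-order sentence $\varphi$ is in standard form if $\varphi = \forall \vec{x}_1 \exists \vec{y}_1 \ldots \forall \vec{x}_n \exists \vec{y}_n.\,\psi$, where the $\vec{x}_i,\vec{y}_i$ are tuples of variables ($\vec{x}_1$ and $\vec{y}_n$ may be empty), $\psi$ is quantifier-free, in negation normal form and uses only the connectives $\wedge,\vee,\neg$, every variable bound in the prefix occurs in $\psi$, and no variable is bound by two quantifier occurrences. Write $\vec{x} := \vec{x}_1\cup\ldots\cup\vec{x}_n$, $\vec{y}:=\vec{y}_1\cup\ldots\cup\vec{y}_n$, let $\mathrm{At}$ be the set of atoms occurring in $\varphi$, and let $\mathrm{vars}(S)$ denote the set of variables occurring in a set $S$ of atoms. A sentence $\varphi$ in standard form that may contain the equality predicate and constant symbols but no non-constant function symbols belongs to the generalized Bernays–Schönfinkel–Ramsey fragment (GBSR) iff $\mathrm{At}$ can be partitioned into (possibly empty) sets $\mathrm{At}_0,\ldots,\mathrm{At}_n$ such that (i) for every $0\le i\le n$: $\mathrm{vars}(\mathrm{At}_i)\subseteq \vec{y}_1\cup\ldots\cup\vec{y}_i\cup\vec{x}_{i+1}\cup\ldots\cup\vec{x}_n$, and (ii) for all $0\le i<j\le n$: $\mathrm{vars}(\mathrm{At}_i)\cap\mathrm{vars}(\mathrm{At}_j)\cap\vec{x}=\emptyset$. *)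

theory Defs
  imports Main "HOL-Library.Nat_Bijection" "HOL-Library.Disjoint_Sets"
begin

section \<open>First-order logic with equality\<close>

text \<open>
  The vocabulary is countable: variables, function symbols and predicate symbols are named by
  natural numbers. The arity of a symbol occurrence is the length of its argument list, so a
  symbol is a name together with an arity; constants are the function symbols applied to
  the empty list.
\<close>

datatype tm = Var nat | Fun nat "tm list"

datatype atom = Pred nat "tm list" | Eq tm tm

datatype fm =
    Atom atom
  | Neg fm
  | Con fm fm
  | Dis fm fm
  | Imp fm fm
  | Iff fm fm
  | All nat fm
  | Ex nat fm

fun tm_vars :: "tm \<Rightarrow> nat set" where
  "tm_vars (Var x) = {x}"
| "tm_vars (Fun f ts) = (\<Union>t\<in>set ts. tm_vars t)"

fun atom_tms :: "atom \<Rightarrow> tm set" where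
  "atom_tms (Pred p ts) = set ts"
| "atom_tms (Eq s t) = {s, t}"

definition vars :: "atom set \<Rightarrow> nat set" where
  "vars S = (\<Union>a\<in>S. \<Union>t\<in>atom_tms a. tm_vars t)"

fun atoms :: "fm \<Rightarrow> atom set" where
  "atoms (Atom a) = {a}"
| "atoms (Neg p) = atoms p"
| "atoms (Con p q) = atoms p \<union> atoms q"
| "atoms (Dis p q) = atoms p \<union> atoms q"
| "atoms (Imp p q) = atoms p \<union> atoms q"
| "atoms (Iff p q) = atoms p \<union> atoms q"
| "atoms (All x p) = atoms p"
| "atoms (Ex x p) = atoms p"

fun free_vars :: "fm \<Rightarrow> nat set" where
  "free_vars (Atom a) = vars {a}"
| "free_vars (Neg p) = free_vars p"
| "free_vars (Con p q) = free_vars p \<union> free_vars q"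
| "free_vars (Dis p q) = free_vars p \<union> free_vars q"
| "free_vars (Imp p q) = free_vars p \<union> free_vars q"
| "free_vars (Iff p q) = free_vars p \<union> free_vars q"
| "free_vars (All x p) = free_vars p - {x}"
| "free_vars (Ex x p) = free_vars p - {x}"

definition sentence :: "fm \<Rightarrow> bool" where
  "sentence \<phi> \<longleftrightarrow> free_vars \<phi> = {}"

record 'u struct =
  dom :: "'u set"
  fint :: "nat \<Rightarrow> 'u list \<Rightarrow> 'u"
  pint :: "nat \<Rightarrow> 'u list \<Rightarrow> bool"

definition is_struct :: "'u struct \<Rightarrow> bool" where
  "is_struct M \<longleftrightarrow> dom M \<noteq> {} \<and> (\<forall>f us. set us \<subseteq> dom M \<longrightarrow> fint M f us \<in> dom M)"

fun tm_val :: "'u struct \<Rightarrow> (nat \<Rightarrow> 'u) \<Rightarrow> tm \<Rightarrow> 'u" where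
  "tm_val M v (Var x) = v x"
| "tm_val M v (Fun f ts) = fint M f (map (tm_val M v) ts)"

fun atom_val :: "'u struct \<Rightarrow> (nat \<Rightarrow> 'u) \<Rightarrow> atom \<Rightarrow> bool" where
  "atom_val M v (Pred p ts) = pint M p (map (tm_val M v) ts)"
| "atom_val M v (Eq s t) = (tm_val M v s = tm_val M v t)"

fun holds :: "'u struct \<Rightarrow> (nat \<Rightarrow> 'u) \<Rightarrow> fm \<Rightarrow> bool" where
  "holds M v (Atom a) = atom_val M v a"
| "holds M v (Neg p) = (\<not> holds M v p)"
| "holds M v (Con p q) = (holds M v p \<and> holds M v q)"
| "holds M v (Dis p q) = (holds M v p \<or> holds M v q)"
| "holds M v (Imp p q) = (holds M v p \<longrightarrow> holds M v q)"
| "holds M v (Iff p q) = (holds M v p \<longleftrightarrow> holds M v q)"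
| "holds M v (All x p) = (\<forall>u\<in>dom M. holds M (v(x := u)) p)"
| "holds M v (Ex x p) = (\<exists>u\<in>dom M. holds M (v(x := u)) p)"

definition models :: "'u struct \<Rightarrow> fm \<Rightarrow> bool" where
  "models M \<phi> \<longleftrightarrow> is_struct M \<and> (\<forall>v. range v \<subseteq> dom M \<longrightarrow> holds M v \<phi>)"

text \<open>
  The domain of a model may be any nonempty set of elements of type \<open>'u\<close>, finite ones included.
  A HOL formula cannot quantify over types, so \<open>'u\<close> is a parameter. That a sentence has a model is
  witnessed by a model over some type, for instance \<open>nat\<close>; that it has none requires the absence
  of models over every \<open>'u\<close>.
\<close>

definition has_model :: "'u itself \<Rightarrow> fm \<Rightarrow> bool" where
  "has_model _ \<phi> \<longleftrightarrow> (\<exists>M :: 'u struct. models M \<phi>)"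


section \<open>Standard form and GBSR\<close>

text \<open>Negation normal form, quantifier-free and built with conjunction, disjunction, negation.\<close>

fun nnf_matrix :: "fm \<Rightarrow> bool" where
  "nnf_matrix (Atom a) = True"
| "nnf_matrix (Neg (Atom a)) = True"
| "nnf_matrix (Con p q) = (nnf_matrix p \<and> nnf_matrix q)"
| "nnf_matrix (Dis p q) = (nnf_matrix p \<and> nnf_matrix q)"
| "nnf_matrix _ = False"

text \<open>
  A quantifier prefix is a list of pairs: its \<open>i\<close>-th entry, counting from 0, holds the universal
  tuple \<open>x\<^sub>i\<^sub>+\<^sub>1\<close> and the existential tuple \<open>y\<^sub>i\<^sub>+\<^sub>1\<close>.
\<close>

type_synonym prefix = "(nat list \<times> nat list) list"

definition quantify :: "prefix \<Rightarrow> fm \<Rightarrow> fm" where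
  "quantify bs \<psi> = foldr (\<lambda>(xs, ys) p. foldr All xs (foldr Ex ys p)) bs \<psi>"

definition univ_vars :: "prefix \<Rightarrow> nat set" where
  "univ_vars bs = (\<Union>(xs, ys)\<in>set bs. set xs)"

definition ex_vars :: "prefix \<Rightarrow> nat set" where
  "ex_vars bs = (\<Union>(xs, ys)\<in>set bs. set ys)"

definition standard_form :: "prefix \<Rightarrow> fm \<Rightarrow> fm \<Rightarrow> bool" where
  "standard_form bs \<psi> \<phi> \<longleftrightarrow>
     \<phi> = quantify bs \<psi> \<and> sentence \<phi> \<and> nnf_matrix \<psi> \<and>
     bs \<noteq> [] \<and>
     (\<forall>i < length bs. (0 < i \<longrightarrow> fst (bs ! i) \<noteq> []) \<and>
                      (Suc i < length bs \<longrightarrow> snd (bs ! i) \<noteq> [])) \<and>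
     univ_vars bs \<union> ex_vars bs \<subseteq> vars (atoms \<psi>) \<and>
     distinct (concat (map (\<lambda>(xs, ys). xs @ ys) bs))"

fun var_or_const :: "tm \<Rightarrow> bool" where
  "var_or_const (Var x) = True"
| "var_or_const (Fun f ts) = (ts = [])"

definition gbsr :: "fm \<Rightarrow> bool" where
  "gbsr \<phi> \<longleftrightarrow>
     (\<exists>bs \<psi>. standard_form bs \<psi> \<phi> \<and>
       (\<forall>a\<in>atoms \<phi>. \<forall>t\<in>atom_tms a. var_or_const t) \<and>
       (\<exists>At :: nat \<Rightarrow> atom set.
          (\<Union>i\<le>length bs. At i) = atoms \<phi> \<and>
          disjoint_family_on At {..length bs} \<and>
          (\<forall>i\<le>length bs. vars (At i) \<subseteq> ex_vars (take i bs) \<union> univ_vars (drop i bs)) \<and>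
          (\<forall>i j. i < j \<and> j \<le> length bs \<longrightarrow>
                 vars (At i) \<inter> vars (At j) \<inter> univ_vars bs = {})))"


section \<open>Algorithms\<close>

text \<open>
  Partial recursive functions: \<open>rec_eval f ns m\<close> says that \<open>f\<close> terminates on the argument list
  \<open>ns\<close> with result \<open>m\<close>. Primitive recursion and minimization act on the first argument.
\<close>

datatype recf =
    Zero
  | Succ
  | Proj nat
  | Comp recf "recf list"
  | PrimRec recf recf
  | Mu recf

inductive rec_eval :: "recf \<Rightarrow> nat list \<Rightarrow> nat \<Rightarrow> bool" where
  "rec_eval Zero ns 0"
| "rec_eval Succ [n] (Suc n)"
| "i < length ns \<Longrightarrow> rec_eval (Proj i) ns (ns ! i)"
| "list_all2 (\<lambda>g m. rec_eval g ns m) gs ms \<Longrightarrow> rec_eval f ms k \<Longrightarrow> rec_eval (Comp f gs) ns k"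
| "rec_eval f ns k \<Longrightarrow> rec_eval (PrimRec f g) (0 # ns) k"
| "rec_eval (PrimRec f g) (n # ns) m \<Longrightarrow> rec_eval g (n # m # ns) k \<Longrightarrow>
     rec_eval (PrimRec f g) (Suc n # ns) k"
| "rec_eval f (n # ns) 0 \<Longrightarrow> (\<And>i. i < n \<Longrightarrow> \<exists>m. rec_eval f (i # ns) (Suc m)) \<Longrightarrow>
     rec_eval (Mu f) ns n"

lemma rec_eval_deterministic:
  "rec_eval f ns k \<Longrightarrow> rec_eval f ns k' \<Longrightarrow> k = k'"
proof (induction arbitrary: k' rule: rec_eval.induct)
  case (4 ns gs ms f k)
  from "4.prems" obtain ms' where ms': "list_all2 (\<lambda>g m. rec_eval g ns m) gs ms'"
    and k': "rec_eval f ms' k'"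
    by (cases rule: rec_eval.cases) auto
  have "ms = ms'"
    using "4.IH"(1) ms' by (auto simp: list_all2_conv_all_nth intro!: nth_equalityI)
  then show ?case using "4.IH"(2) k' by simp
next
  case (6 f g n ns m k)
  from "6.prems" obtain m' where "rec_eval (PrimRec f g) (n # ns) m'"
    and "rec_eval g (n # m' # ns) k'"
    by (cases rule: rec_eval.cases) auto
  then show ?case using "6.IH" by blast
next
  case (7 f n ns)
  from "7.prems" have z: "rec_eval f (k' # ns) 0"
    and s: "\<And>i. i < k' \<Longrightarrow> \<exists>m. rec_eval f (i # ns) (Suc m)"
    by (cases rule: rec_eval.cases; auto)+
  have "\<not> k' < n" using "7.IH"(2) z by fastforce
  moreover have "\<not> n < k'" using "7.IH"(1) s by fastforce
  ultimately show ?case by simp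
next
  case (5 f ns k g)
  from "5.prems" have "rec_eval f ns k'"
    by (cases rule: rec_eval.cases) auto
  then show ?case by (rule "5.IH")
qed (erule rec_eval.cases; simp)+

fun tm_code :: "tm \<Rightarrow> nat" where
  "tm_code (Var x) = prod_encode (0, x)"
| "tm_code (Fun f ts) = prod_encode (1, prod_encode (f, list_encode (map tm_code ts)))"

fun atom_code :: "atom \<Rightarrow> nat" where
  "atom_code (Pred p ts) = prod_encode (0, prod_encode (p, list_encode (map tm_code ts)))"
| "atom_code (Eq s t) = prod_encode (1, prod_encode (tm_code s, tm_code t))"

fun fm_code :: "fm \<Rightarrow> nat" where
  "fm_code (Atom a) = prod_encode (0, atom_code a)"
| "fm_code (Neg p) = prod_encode (1, fm_code p)"
| "fm_code (Con p q) = prod_encode (2, prod_encode (fm_code p, fm_code q))"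
| "fm_code (Dis p q) = prod_encode (3, prod_encode (fm_code p, fm_code q))"
| "fm_code (Imp p q) = prod_encode (4, prod_encode (fm_code p, fm_code q))"
| "fm_code (Iff p q) = prod_encode (5, prod_encode (fm_code p, fm_code q))"
| "fm_code (All x p) = prod_encode (6, prod_encode (x, fm_code p))"
| "fm_code (Ex x p) = prod_encode (7, prod_encode (x, fm_code p))"

lemma tm_code_inject: "tm_code s = tm_code t \<Longrightarrow> s = t"
proof (induction s arbitrary: t)
  case (Var x)
  then show ?case by (cases t) auto
next
  case (Fun f ss)
  then obtain ts where t: "t = Fun f ts" and "map tm_code ss = map tm_code ts"
    by (cases t) (auto simp: list_encode_eq)
  then have "ss = ts" using Fun.IH
    by (intro nth_equalityI) (auto simp: list_eq_iff_nth_eq)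
  then show ?case using t by simp
qed

lemma inj_atom_code: "inj atom_code"
proof (rule injI)
  fix a b assume "atom_code a = atom_code b"
  moreover have "inj tm_code" by (simp add: injI tm_code_inject)
  ultimately show "a = b"
    by (cases a; cases b) (auto simp: list_encode_eq dest: tm_code_inject)
qed

lemma inj_fm_code: "inj fm_code"
proof (rule injI)
  show "fm_code p = fm_code q \<Longrightarrow> p = q" for p q
    by (induction p arbitrary: q; case_tac q) (auto dest: injD[OF inj_atom_code])
qed

end

theory Submission
  imports Defs "HOL-Library.FuncSet"
begin

text \<open>
  Consider the evaluation game of a GBSR sentence in a model. An atom of part \<open>i\<close> of the partition
  contains only existential variables that are chosen before all its universal ones, and the parts
  share no universal variables. So the universal choices made so far influence the rest of the game
  only through one fingerprint per part: the set of true atoms at the end of the game, and the set of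
  fingerprints reachable by the next universal choice before that. There are finitely many
  fingerprints, and the existential player may answer by a function of the fingerprints and of its
  own earlier choices. Its answers and the constants then form a finite submodel, whose size is
  bounded by a computable function of the code of the sentence. To decide satisfiability, search
  all structures up to that size.
\<close>

section \<open>Closure properties of the computable functions\<close>

text \<open>A Skolem function answers every tuple of earlier universal choices separately, so its
  range may be infinite. The dependence is therefore cut down to finitely many cases inside the
  given model, whose elements are neither merged nor copied. Only the domain shrinks: the universal
  player keeps only moves that were legal before, and the existential player loses nothing once its
  stored answers remain. Answers depend on earlier answers, so the domain is enlarged once per
  existential quantifier, from left to right.

  Fingerprints are iterated power sets because a set of reachable fingerprints is exactly what
  allows one universal move to be matched by another.

  The code \<open>c\<close> of the sentence bounds, up to one, the number of its variables, atoms,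
  parts and quantifiers, and also its constant names, predicate names and arities. Hence all search
  bounds are functions of \<open>c\<close> alone, and the algorithm never looks for a prefix or a
  partition. Truth is evaluated by a table indexed by codes, since primitive recursion runs over
  numbers and not over formulas.\<close>

text \<open>Arguments are read off an environment, so that binders shift indices by \<open>\<lambda>i. v (Suc i)\<close> and
  the introduction rules below apply by higher-order pattern unification.\<close>

definition computable :: "nat \<Rightarrow> ((nat \<Rightarrow> nat) \<Rightarrow> nat) \<Rightarrow> bool" where
  "computable k F \<longleftrightarrow> (\<exists>r. \<forall>v. rec_eval r (map v [0..<k]) (F v))"

abbreviation decidable :: "nat \<Rightarrow> ((nat \<Rightarrow> nat) \<Rightarrow> bool) \<Rightarrow> bool" where
  "decidable k P \<equiv> computable k (\<lambda>v. of_bool (P v))"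

named_theorems computable_intros

lemma map_upt_Suc_Cons: "map v [0..<Suc k] = v 0 # map (\<lambda>i. v (Suc i)) [0..<k]"
proof -
  have "[0..<Suc k] = 0 # map Suc [0..<k]" by (simp add: upt_conv_Cons map_Suc_upt)
  then show ?thesis by (simp add: comp_def)
qed

lemma computable_arg [computable_intros]: "i < k \<Longrightarrow> computable k (\<lambda>v. v i)"
  unfolding computable_def
proof (intro exI allI)
  fix v :: "nat \<Rightarrow> nat" assume "i < k"
  then show "rec_eval (Proj i) (map v [0..<k]) (v i)"
    using rec_eval.intros(3)[of i "map v [0..<k]"] by simp
qed

lemma computable_compose:
  assumes G: "computable m G" and Fs: "\<And>i. i < m \<Longrightarrow> computable k (Fs i)"
  shows "computable k (\<lambda>v. G (\<lambda>i. Fs i v))"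
proof -
  from G obtain g where g: "\<And>v. rec_eval g (map v [0..<m]) (G v)"
    unfolding computable_def by blast
  from Fs have "\<forall>i. \<exists>r. i < m \<longrightarrow> (\<forall>v. rec_eval r (map v [0..<k]) (Fs i v))"
    unfolding computable_def by blast
  then obtain r where r: "\<And>i v. i < m \<Longrightarrow> rec_eval (r i) (map v [0..<k]) (Fs i v)"
    by metis
  have "rec_eval (Comp g (map r [0..<m])) (map v [0..<k]) (G (\<lambda>i. Fs i v))" for v
    by (rule rec_eval.intros(4)[OF _ g]) (auto simp: list_all2_conv_all_nth r)
  then show ?thesis unfolding computable_def by blast
qed

lemma computable_shift: "computable k F \<Longrightarrow> computable (Suc k) (\<lambda>v. F (\<lambda>i. v (Suc i)))"
  by (erule computable_compose) (simp add: computable_arg)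

lemma computable_compose1:
  assumes "computable 1 (\<lambda>v. F (v 0))" "computable k A"
  shows "computable k (\<lambda>v. F (A v))"
  using computable_compose[OF assms(1), of k "\<lambda>_. A"] assms(2) by simp

lemma computable_compose2:
  assumes "computable 2 (\<lambda>v. F (v 0) (v 1))" "computable k A" "computable k B"
  shows "computable k (\<lambda>v. F (A v) (B v))"
  using computable_compose[OF assms(1), of k "\<lambda>i. if i = 0 then A else B"] assms(2,3) by simp

lemma computable_Suc [computable_intros]:
  assumes "computable k A"
  shows "computable k (\<lambda>v. Suc (A v))"
proof (rule computable_compose1[OF _ assms])
  show "computable 1 (\<lambda>v. Suc (v 0))"
    unfolding computable_def by (rule exI[of _ Succ]) (simp add: rec_eval.intros(2))
qed

lemma computable_const [computable_intros]: "computable k (\<lambda>v. c)"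
proof (induction c)
  case 0
  show ?case unfolding computable_def by (rule exI[of _ Zero]) (simp add: rec_eval.intros(1))
qed (rule computable_Suc)

text \<open>The step function reads counter, previous value and parameters in the order that
  \<open>rec_eval\<close> prescribes for \<open>PrimRec\<close>. Later recursions are restated with
  \<open>rec_nat\<close> to fit here.\<close>

lemma computable_rec_nat:
  assumes A: "computable k A" and F: "computable k F"
    and G: "computable (Suc (Suc k)) (\<lambda>v. G (v 0) (v 1) (\<lambda>i. v (Suc (Suc i))))"
  shows "computable k (\<lambda>v. rec_nat (F v) (\<lambda>n m. G n m v) (A v))"
proof -
  from F obtain f where f: "\<And>v. rec_eval f (map v [0..<k]) (F v)"
    unfolding computable_def by blast
  from G obtain g where
    g: "\<And>v. rec_eval g (map v [0..<Suc (Suc k)]) (G (v 0) (v 1) (\<lambda>i. v (Suc (Suc i))))"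
    unfolding computable_def by blast
  have g': "rec_eval g (n # m # map v [0..<k]) (G n m v)" for n m v
    using g[of "case_nat n (case_nat m v)"] by (simp add: map_upt_Suc_Cons del: upt_Suc)
  have "rec_eval (PrimRec f g) (n # map v [0..<k]) (rec_nat (F v) (\<lambda>n m. G n m v) n)" for n v
  proof (induction n)
    case 0
    show ?case using f by (simp add: rec_eval.intros(5))
  next
    case (Suc n)
    then show ?case using g' by (simp add: rec_eval.intros(6))
  qed
  from this[of "v 0" "\<lambda>i. v (Suc i)" for v]
  have *: "computable (Suc k) (\<lambda>v. rec_nat (F (\<lambda>i. v (Suc i))) (\<lambda>n m. G n m (\<lambda>i. v (Suc i))) (v 0))"
    unfolding computable_def map_upt_Suc_Cons by blast
  have "computable k (\<lambda>v. case i of 0 \<Rightarrow> A v | Suc j \<Rightarrow> v j)" if "i < Suc k" for i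
    using that A by (cases i) (auto intro: computable_arg)
  from computable_compose[OF *, of k "\<lambda>i v. case i of 0 \<Rightarrow> A v | Suc j \<Rightarrow> v j", OF this]
  show ?thesis by simp
qed

lemma computable_add [computable_intros]:
  assumes "computable k A" "computable k B"
  shows "computable k (\<lambda>v. A v + B v)"
proof -
  have "rec_nat b (\<lambda>n m. Suc m) a = a + b" for a b :: nat by (induction a) auto
  moreover have "computable k (\<lambda>v. rec_nat (B v) (\<lambda>n m. Suc m) (A v))"
    by (intro computable_rec_nat computable_intros assms) simp
  ultimately show ?thesis by simp
qed

lemma computable_mult [computable_intros]:
  assumes "computable k A" "computable k B"
  shows "computable k (\<lambda>v. A v * B v)"
proof (rule computable_compose2[OF _ assms])
  have "rec_nat 0 (\<lambda>n m. m + b) a = a * b" for a b :: nat by (induction a) auto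
  moreover have "computable 2 (\<lambda>v. rec_nat 0 (\<lambda>n m. m + v 1) (v 0))"
    by (intro computable_rec_nat computable_intros) simp_all
  ultimately show "computable 2 (\<lambda>v. v 0 * v 1)" by simp
qed

lemma computable_power [computable_intros]:
  assumes "computable k A" "computable k B"
  shows "computable k (\<lambda>v. A v ^ B v)"
proof (rule computable_compose2[OF _ assms])
  have "rec_nat 1 (\<lambda>n m. a * m) b = a ^ b" for a b :: nat by (induction b) auto
  moreover have "computable 2 (\<lambda>v. rec_nat 1 (\<lambda>n m. v 0 * m) (v 1))"
    by (intro computable_rec_nat computable_intros) simp_all
  ultimately show "computable 2 (\<lambda>v. v 0 ^ v 1)" by simp
qed

lemma computable_diff [computable_intros]:
  assumes "computable k A" "computable k B"
  shows "computable k (\<lambda>v. A v - B v)"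
proof (rule computable_compose2[OF _ assms])
  have "rec_nat 0 (\<lambda>n m. n) a = a - 1" for a :: nat by (cases a) auto
  moreover have "computable 1 (\<lambda>v. rec_nat 0 (\<lambda>n m. n) (v 0))"
    by (intro computable_rec_nat computable_intros) simp_all
  ultimately have pred: "computable 1 (\<lambda>v. v 0 - 1)" by simp
  have "rec_nat a (\<lambda>n m. m - 1) b = a - b" for a b :: nat by (induction b) auto
  moreover have "computable 2 (\<lambda>v. rec_nat (v 0) (\<lambda>n m. m - 1) (v 1))"
    by (intro computable_rec_nat computable_compose1[OF pred] computable_intros) simp_all
  ultimately show "computable 2 (\<lambda>v. v 0 - v 1)" by simp
qed

lemma decidable_le [computable_intros]:
  assumes "computable k A" "computable k B"
  shows "decidable k (\<lambda>v. A v \<le> B v)"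
proof -
  have "computable k (\<lambda>v. 1 - (A v - B v))" by (intro computable_intros assms)
  moreover have "1 - (A v - B v) = of_bool (A v \<le> B v)" for v by auto
  ultimately show ?thesis by simp
qed

lemma decidable_not [computable_intros]:
  assumes "decidable k P"
  shows "decidable k (\<lambda>v. \<not> P v)"
proof -
  have "computable k (\<lambda>v. 1 - of_bool (P v))" by (intro computable_intros assms)
  moreover have "1 - of_bool (P v) = (of_bool (\<not> P v) :: nat)" for v by simp
  ultimately show ?thesis by simp
qed

lemma decidable_conj [computable_intros]:
  assumes "decidable k P" "decidable k Q"
  shows "decidable k (\<lambda>v. P v \<and> Q v)"
  unfolding of_bool_conj by (intro computable_intros assms)

lemma decidable_disj [computable_intros]:
  assumes "decidable k P" "decidable k Q"
  shows "decidable k (\<lambda>v. P v \<or> Q v)"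
proof -
  have "decidable k (\<lambda>v. \<not> (\<not> P v \<and> \<not> Q v))" by (intro computable_intros assms)
  then show ?thesis by simp
qed

lemma decidable_imp [computable_intros]:
  assumes "decidable k P" "decidable k Q"
  shows "decidable k (\<lambda>v. P v \<longrightarrow> Q v)"
  unfolding imp_conv_disj by (intro computable_intros assms)

lemma decidable_iff [computable_intros]:
  assumes "decidable k P" "decidable k Q"
  shows "decidable k (\<lambda>v. P v = Q v)"
  unfolding iff_conv_conj_imp by (intro computable_intros assms)

lemma decidable_eq [computable_intros]:
  assumes "computable k A" "computable k B"
  shows "decidable k (\<lambda>v. A v = B v)"
  unfolding order_eq_iff by (intro computable_intros assms)

lemma decidable_less [computable_intros]:
  assumes "computable k A" "computable k B"
  shows "decidable k (\<lambda>v. A v < B v)"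
  unfolding less_eq_Suc_le by (intro computable_intros assms)

lemma computable_if [computable_intros]:
  assumes "decidable k P" "computable k A" "computable k B"
  shows "computable k (\<lambda>v. if P v then A v else B v)"
proof -
  have "computable k (\<lambda>v. of_bool (P v) * A v + of_bool (\<not> P v) * B v)"
    by (intro computable_intros assms)
  moreover have "of_bool (P v) * A v + of_bool (\<not> P v) * B v = (if P v then A v else B v)" for v
    by simp
  ultimately show ?thesis by simp
qed

text \<open>\<open>Mu\<close> searches for a zero, so the negated test is minimized;
  \<open>ex\<close> makes the search stop in every environment.\<close>

lemma computable_Least:
  assumes P: "decidable (Suc k) (\<lambda>v. P (v 0) (\<lambda>i. v (Suc i)))" and ex: "\<And>v. \<exists>i. P i v"
  shows "computable k (\<lambda>v. LEAST i. P i v)"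
proof -
  from decidable_not[OF P] obtain r where
    r: "\<And>v. rec_eval r (map v [0..<Suc k]) (of_bool (\<not> P (v 0) (\<lambda>i. v (Suc i))))"
    unfolding computable_def by blast
  have r': "rec_eval r (i # map v [0..<k]) (of_bool (\<not> P i v))" for i v
    using r[of "case_nat i v"] by (simp add: map_upt_Suc_Cons del: upt_Suc)
  have "rec_eval (Mu r) (map v [0..<k]) (LEAST i. P i v)" for v
  proof (rule rec_eval.intros(7))
    show "rec_eval r ((LEAST i. P i v) # map v [0..<k]) 0"
      using r'[of "LEAST i. P i v" v] LeastI_ex[OF ex[of v]] by simp
    show "\<exists>m. rec_eval r (i # map v [0..<k]) (Suc m)" if "i < (LEAST i. P i v)" for i
      using r'[of i v] not_less_Least[OF that] by auto
  qed
  then show ?thesis unfolding computable_def by blast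
qed

text \<open>Accepting every index from the bound on makes the search total; a witness exists iff the
  search stops below the bound.\<close>

lemma decidable_bex [computable_intros]:
  assumes "computable k B" "decidable (Suc k) (\<lambda>v. P (v 0) (\<lambda>i. v (Suc i)))"
  shows "decidable k (\<lambda>v. \<exists>i<B v. P i v)"
proof -
  have "computable k (\<lambda>v. LEAST i. P i v \<or> B v \<le> i)"
    by (intro computable_Least computable_intros computable_shift assms) auto
  then have "decidable k (\<lambda>v. (LEAST i. P i v \<or> B v \<le> i) < B v)"
    by (intro computable_intros assms)
  moreover have "(LEAST i. P i v \<or> B v \<le> i) < B v \<longleftrightarrow> (\<exists>i<B v. P i v)" for v
  proof
    assume *: "(LEAST i. P i v \<or> B v \<le> i) < B v"
    have "P (LEAST i. P i v \<or> B v \<le> i) v \<or> B v \<le> (LEAST i. P i v \<or> B v \<le> i)"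
      by (rule LeastI[of _ "B v"]) simp
    with * show "\<exists>i<B v. P i v" by auto
  next
    assume "\<exists>i<B v. P i v"
    then obtain i where "i < B v" "P i v" by blast
    then show "(LEAST i. P i v \<or> B v \<le> i) < B v"
      using Least_le[of "\<lambda>i. P i v \<or> B v \<le> i" i] by simp
  qed
  ultimately show ?thesis by simp
qed

lemma decidable_ball [computable_intros]:
  assumes "computable k B" "decidable (Suc k) (\<lambda>v. P (v 0) (\<lambda>i. v (Suc i)))"
  shows "decidable k (\<lambda>v. \<forall>i<B v. P i v)"
proof -
  have "decidable k (\<lambda>v. \<not> (\<exists>i<B v. \<not> P i v))" by (intro computable_intros assms)
  then show ?thesis by simp
qed

lemma computable_div [computable_intros]:
  assumes "computable k A" "computable k B"
  shows "computable k (\<lambda>v. A v div B v)"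
proof (rule computable_compose2[OF _ assms])
  \<comment> \<open>The disjunct \<open>b = 0\<close> keeps the search total and makes it return 0,
    in agreement with \<open>a div 0 = 0\<close>.\<close>
  have ex: "\<exists>q. b = 0 \<or> a < Suc q * b" for a b :: nat
    by (cases b) (auto intro!: exI[of _ a])
  have "(LEAST q. b = 0 \<or> a < Suc q * b) = a div b" for a b :: nat
  proof (cases "b = 0")
    case False
    show ?thesis
    proof (rule Least_equality)
      show "b = 0 \<or> a < Suc (a div b) * b"
        using dividend_less_div_times[of b a] False by simp
      show "a div b \<le> q" if "b = 0 \<or> a < Suc q * b" for q
        using that False less_mult_imp_div_less[of a "Suc q" b] by simp
    qed
  qed (simp add: Least_equality)
  moreover have "computable 2 (\<lambda>v. LEAST q. v 1 = 0 \<or> v 0 < Suc q * v 1)"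
    by (intro computable_Least computable_intros ex) simp_all
  ultimately show "computable 2 (\<lambda>v. v 0 div v 1)" by simp
qed

lemma computable_mod [computable_intros]:
  assumes "computable k A" "computable k B"
  shows "computable k (\<lambda>v. A v mod B v)"
  unfolding modulo_nat_def by (intro computable_intros assms)

lemma computable_prod_encode [computable_intros]:
  assumes "computable k A" "computable k B"
  shows "computable k (\<lambda>v. prod_encode (A v, B v))"
  unfolding prod_encode_def triangle_def prod.case by (intro computable_intros assms)

abbreviation pfst :: "nat \<Rightarrow> nat" where "pfst z \<equiv> fst (prod_decode z)"
abbreviation psnd :: "nat \<Rightarrow> nat" where "psnd z \<equiv> snd (prod_decode z)"

lemma prod_encode_pfst_psnd [simp]: "prod_encode (pfst z, psnd z) = z"
  by simp

lemma psnd_le: "psnd z \<le> z"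
  using le_prod_encode_2[of "psnd z" "pfst z"] by simp

lemma computable_pfst [computable_intros]:
  assumes "computable k A"
  shows "computable k (\<lambda>v. pfst (A v))"
proof (rule computable_compose1[OF _ assms])
  have ex: "\<exists>a. \<exists>b<Suc z. prod_encode (a, b) = z" for z
    using psnd_le[of z] by (intro exI[of _ "pfst z"] exI[of _ "psnd z"]) simp
  have "(LEAST a. \<exists>b<Suc z. prod_encode (a, b) = z) = pfst z" for z
  proof (rule Least_equality)
    show "\<exists>b<Suc z. prod_encode (pfst z, b) = z"
      using psnd_le[of z] by (intro exI[of _ "psnd z"]) simp
  qed auto
  moreover have "computable 1 (\<lambda>v. LEAST a. \<exists>b<Suc (v 0). prod_encode (a, b) = v 0)"
    by (intro computable_Least computable_intros ex) simp_all
  ultimately show "computable 1 (\<lambda>v. pfst (v 0))" by simp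
qed

lemma computable_psnd [computable_intros]:
  assumes "computable k A"
  shows "computable k (\<lambda>v. psnd (A v))"
proof (rule computable_compose1[OF _ assms])
  have ex: "\<exists>b. prod_encode (pfst z, b) = z" for z
    by (intro exI[of _ "psnd z"]) simp
  have "(LEAST b. prod_encode (pfst z, b) = z) = psnd z" for z
  proof (rule Least_equality)
    show "psnd z \<le> b" if "prod_encode (pfst z, b) = z" for b
      using that by (metis order_refl prod_encode_inverse snd_conv)
  qed simp
  moreover have "computable 1 (\<lambda>v. LEAST b. prod_encode (pfst (v 0), b) = v 0)"
    by (intro computable_Least computable_intros ex) simp_all
  ultimately show "computable 1 (\<lambda>v. psnd (v 0))" by simp
qed

lemma decidable_set_decode [computable_intros]:
  assumes "computable k A" "computable k B"
  shows "decidable k (\<lambda>v. A v \<in> set_decode (B v))"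
proof -
  have "a \<in> set_decode b \<longleftrightarrow> (b div 2 ^ a) mod 2 = 1" for a b
    by (simp add: set_decode_def odd_iff_mod_2_eq_one)
  then show ?thesis by (simp only:) (intro computable_intros assms)
qed

section \<open>Deciding truth in a finite structure\<close>

definition digit :: "nat \<Rightarrow> nat \<Rightarrow> nat \<Rightarrow> nat" where
  "digit n e i = e div n ^ i mod n"

text \<open>The number \<open>K\<close> lists the values of the constants in base \<open>n\<close>, and the binary digits of \<open>R\<close>
  tabulate the predicates.\<close>

definition struct_of :: "nat \<Rightarrow> nat \<Rightarrow> nat \<Rightarrow> nat struct" where
  "struct_of n K R = \<lparr>dom = {..<n}, fint = (\<lambda>f us. digit n K f),
     pint = (\<lambda>p us. prod_encode (p, list_encode us) \<in> set_decode R)\<rparr>"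

text \<open>The code of a nonempty list is the successor of a pair code, so subtracting 1 and
  projecting gives the tail; 0, the empty list, is a fixed point.\<close>

primrec list_drop :: "nat \<Rightarrow> nat \<Rightarrow> nat" where
  "list_drop 0 z = z"
| "list_drop (Suc i) z = psnd (list_drop i z - 1)"

definition tm_value :: "nat \<Rightarrow> nat \<Rightarrow> nat \<Rightarrow> nat \<Rightarrow> nat" where
  "tm_value n K e t = (if pfst t = 0 then digit n e (psnd t) else digit n K (pfst (psnd t)))"

text \<open>The code \<open>ts\<close> is at least the length of the list it codes, so the range
  reaches the end of that list, where the emptiness tests compare the lengths.\<close>

definition args_match :: "nat \<Rightarrow> nat \<Rightarrow> nat \<Rightarrow> nat \<Rightarrow> nat \<Rightarrow> bool" where
  "args_match n K e ts us \<longleftrightarrow>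
     (\<forall>i<Suc ts. (list_drop i ts = 0) = (list_drop i us = 0) \<and>
       (list_drop i ts \<noteq> 0 \<longrightarrow>
         pfst (list_drop i us - 1) = tm_value n K e (pfst (list_drop i ts - 1))))"

text \<open>Instead of computing the code of the list of argument values, the search runs through
  the entries of the predicate table, all of which are below \<open>R\<close>.\<close>

definition atom_true :: "nat \<Rightarrow> nat \<Rightarrow> nat \<Rightarrow> nat \<Rightarrow> nat \<Rightarrow> bool" where
  "atom_true n K R e a \<longleftrightarrow>
     (pfst a = 0 \<and> (\<exists>q<R. q \<in> set_decode R \<and> pfst q = pfst (psnd a) \<and>
                          args_match n K e (psnd (psnd a)) (psnd q))) \<or>
     (pfst a = 1 \<and> tm_value n K e (pfst (psnd a)) = tm_value n K e (psnd (psnd a)))"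

text \<open>Assignments to the variables up to \<open>c\<close> are the numbers below \<open>E = n ^ Suc c\<close>, written in
  base \<open>n\<close>. Bit \<open>E * a + e\<close> of the truth table tells whether the formula with code \<open>a\<close> holds under
  the assignment \<open>e\<close>. The codes of subformulas are smaller, so the truth values of the subformulas
  under all assignments stand at lower positions of the table.\<close>

definition truth_clause :: "nat \<Rightarrow> nat \<Rightarrow> nat \<Rightarrow> nat \<Rightarrow> nat \<Rightarrow> nat \<Rightarrow> nat \<Rightarrow> nat \<Rightarrow> bool" where
  "truth_clause c n K R E e a h \<longleftrightarrow>
     (pfst a = 0 \<and> atom_true n K R e (psnd a)) \<or>
     (pfst a = 1 \<and> E * psnd a + e \<notin> set_decode h) \<or>
     (pfst a = 2 \<and> E * pfst (psnd a) + e \<in> set_decode h \<and>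
                   E * psnd (psnd a) + e \<in> set_decode h) \<or>
     (pfst a = 3 \<and> (E * pfst (psnd a) + e \<in> set_decode h \<or>
                   E * psnd (psnd a) + e \<in> set_decode h)) \<or>
     (pfst a = 4 \<and> (E * pfst (psnd a) + e \<in> set_decode h \<longrightarrow>
                   E * psnd (psnd a) + e \<in> set_decode h)) \<or>
     (pfst a = 5 \<and> (E * pfst (psnd a) + e \<in> set_decode h) =
                   (E * psnd (psnd a) + e \<in> set_decode h)) \<or>
     (pfst a = 6 \<and> (\<forall>e'<E. (\<forall>i<Suc c. i \<noteq> pfst (psnd a) \<longrightarrow> digit n e' i = digit n e i) \<longrightarrow>
                          E * psnd (psnd a) + e' \<in> set_decode h)) \<or>
     (pfst a = 7 \<and> (\<exists>e'<E. (\<forall>i<Suc c. i \<noteq> pfst (psnd a) \<longrightarrow> digit n e' i = digit n e i) \<and>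
                          E * psnd (psnd a) + e' \<in> set_decode h))"

text \<open>Course-of-values recursion: the accumulated number is the history of all earlier truth
  values, and adding \<open>2 ^ k\<close> sets the still clear bit \<open>k\<close>.\<close>

primrec truth_table :: "nat \<Rightarrow> nat \<Rightarrow> nat \<Rightarrow> nat \<Rightarrow> nat \<Rightarrow> nat" where
  "truth_table c n K R 0 = 0"
| "truth_table c n K R (Suc k) = truth_table c n K R k +
     (if truth_clause c n K R (n ^ Suc c) (k mod n ^ Suc c) (k div n ^ Suc c)
           (truth_table c n K R k)
      then 2 ^ k else 0)"

text \<open>Along a prefix of length \<open>k\<close>, fingerprints are sets nested \<open>k\<close> times over the codes of atoms
  (at most \<open>c\<close>), coded by numbers. An existential quantifier adds to a domain of size \<open>d\<close> one element
  for each choice of values of the at most \<open>Suc c\<close> earlier existential variables and of fingerprints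
  of the at most \<open>Suc c\<close> parts.\<close>

primrec fp_bound :: "nat \<Rightarrow> nat \<Rightarrow> nat" where
  "fp_bound c 0 = 2 ^ Suc c"
| "fp_bound c (Suc k) = 2 ^ fp_bound c k"

definition growth :: "nat \<Rightarrow> nat \<Rightarrow> nat" where
  "growth c d = d + d ^ Suc c * fp_bound c (Suc c) ^ Suc c"

text \<open>The start value counts the constants named up to \<open>c\<close> and one further
  element; the number of iterations bounds the length of the prefix.\<close>

definition size_bound :: "nat \<Rightarrow> nat" where
  "size_bound c = (growth c ^^ Suc c) (Suc (Suc c))"

text \<open>The code of \<open>k\<close> copies of \<open>n\<close>, which is the largest code of a
  list of length at most \<open>k\<close> with entries at most \<open>n\<close>.\<close>

primrec list_bound :: "nat \<Rightarrow> nat \<Rightarrow> nat" where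
  "list_bound n 0 = 0"
| "list_bound n (Suc k) = Suc (prod_encode (n, list_bound n k))"

text \<open>\<open>K\<close> has one base-\<open>n\<close> digit per constant name up to
  \<open>c\<close>; the bound on \<open>R\<close> leaves a bit for every predicate name up to
  \<open>c\<close> with an argument list of length up to \<open>c\<close>. Bit
  \<open>n ^ Suc c * c\<close> belongs to the formula with code \<open>c\<close> under the
  assignment 0.\<close>

definition has_small_model :: "nat \<Rightarrow> bool" where
  "has_small_model c \<longleftrightarrow>
     (\<exists>n<Suc (size_bound c). \<exists>K<n ^ Suc c.
        \<exists>R<2 ^ Suc (prod_encode (c, list_bound (size_bound c) c)).
        n \<noteq> 0 \<and> n ^ Suc c * c \<in> set_decode (truth_table c n K R (Suc (n ^ Suc c * c))))"

section \<open>Computability of the bounded search\<close>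

lemma computable_digit [computable_intros]:
  assumes "computable k A" "computable k B" "computable k C"
  shows "computable k (\<lambda>v. digit (A v) (B v) (C v))"
  unfolding digit_def by (intro computable_intros assms)

lemma computable_list_drop [computable_intros]:
  assumes "computable k A" "computable k B"
  shows "computable k (\<lambda>v. list_drop (A v) (B v))"
proof (rule computable_compose2[OF _ assms])
  have "rec_nat z (\<lambda>n m. psnd (m - 1)) i = list_drop i z" for z i by (induction i) auto
  moreover have "computable 2 (\<lambda>v. rec_nat (v 1) (\<lambda>n m. psnd (m - 1)) (v 0))"
    by (intro computable_rec_nat computable_intros) simp_all
  ultimately show "computable 2 (\<lambda>v. list_drop (v 0) (v 1))" by simp
qed

lemma computable_tm_value [computable_intros]:
  assumes "computable k A" "computable k B" "computable k C" "computable k D"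
  shows "computable k (\<lambda>v. tm_value (A v) (B v) (C v) (D v))"
  unfolding tm_value_def by (intro computable_intros assms)

lemma computable_fp_bound [computable_intros]:
  assumes "computable k A" "computable k B"
  shows "computable k (\<lambda>v. fp_bound (A v) (B v))"
proof (rule computable_compose2[OF _ assms])
  have "rec_nat (2 ^ Suc c) (\<lambda>n m. 2 ^ m) i = fp_bound c i" for c i by (induction i) auto
  moreover have "computable 2 (\<lambda>v. rec_nat (2 ^ Suc (v 0)) (\<lambda>n m. 2 ^ m) (v 1))"
    by (intro computable_rec_nat computable_intros) simp_all
  ultimately show "computable 2 (\<lambda>v. fp_bound (v 0) (v 1))" by simp
qed

lemma computable_size_bound [computable_intros]:
  assumes "computable k A"
  shows "computable k (\<lambda>v. size_bound (A v))"
proof (rule computable_compose1[OF _ assms])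
  have "rec_nat (Suc (Suc c)) (\<lambda>n m. m + m ^ Suc c * fp_bound c (Suc c) ^ Suc c) i =
      (growth c ^^ i) (Suc (Suc c))" for c i
    by (induction i) (auto simp: growth_def)
  moreover have "computable 1 (\<lambda>v. rec_nat (Suc (Suc (v 0)))
      (\<lambda>n m. m + m ^ Suc (v 0) * fp_bound (v 0) (Suc (v 0)) ^ Suc (v 0)) (Suc (v 0)))"
    by (intro computable_rec_nat computable_intros) simp_all
  ultimately show "computable 1 (\<lambda>v. size_bound (v 0))" by (simp only: size_bound_def)
qed

lemma computable_list_bound [computable_intros]:
  assumes "computable k A" "computable k B"
  shows "computable k (\<lambda>v. list_bound (A v) (B v))"
proof (rule computable_compose2[OF _ assms])
  have "rec_nat 0 (\<lambda>i m. Suc (prod_encode (n, m))) i = list_bound n i" for n i by (induction i) auto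
  moreover have "computable 2 (\<lambda>v. rec_nat 0 (\<lambda>i m. Suc (prod_encode (v 0, m))) (v 1))"
    by (intro computable_rec_nat computable_intros) simp_all
  ultimately show "computable 2 (\<lambda>v. list_bound (v 0) (v 1))" by simp
qed

lemma computable_truth_table [computable_intros]:
  assumes "computable k A" "computable k B" "computable k C" "computable k D" "computable k E"
  shows "computable k (\<lambda>v. truth_table (A v) (B v) (C v) (D v) (E v))"
proof -
  have "rec_nat 0 (\<lambda>k m. m + (if truth_clause c n K R (n ^ Suc c) (k mod n ^ Suc c)
      (k div n ^ Suc c) m then 2 ^ k else 0)) i = truth_table c n K R i" for c n K R i
    by (induction i) auto
  moreover have "computable 5 (\<lambda>v. rec_nat 0 (\<lambda>k m. m + (if truth_clause (v 0) (v 1) (v 2) (v 3)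
      (v 1 ^ Suc (v 0)) (k mod v 1 ^ Suc (v 0)) (k div v 1 ^ Suc (v 0)) m
      then 2 ^ k else 0)) (v 4))"
    unfolding truth_clause_def atom_true_def args_match_def
    by (intro computable_rec_nat computable_intros) simp_all
  ultimately have *: "computable 5 (\<lambda>v. truth_table (v 0) (v 1) (v 2) (v 3) (v 4))" by simp
  have "computable k ([A, B, C, D, E] ! i)" if "i < 5" for i
  proof -
    have "i = 0 \<or> i = 1 \<or> i = 2 \<or> i = 3 \<or> i = 4" using that by auto
    then show ?thesis using assms by auto
  qed
  from computable_compose[OF *, of k "\<lambda>i. [A, B, C, D, E] ! i", OF this]
  show ?thesis by simp
qed

lemma decidable_has_small_model: "decidable 1 (\<lambda>v. has_small_model (v 0))"
  unfolding has_small_model_def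
  by (intro computable_intros) simp_all

section \<open>Coincidence lemmas and size estimates for codes\<close>

lemma tm_val_cong: "(\<And>x. x \<in> tm_vars t \<Longrightarrow> v x = v' x) \<Longrightarrow> tm_val M v t = tm_val M v' t"
proof (induction t)
  case (Fun f ts)
  then have "map (tm_val M v) ts = map (tm_val M v') ts" by auto
  then show ?case by (simp only: tm_val.simps)
qed simp

lemma atom_val_cong:
  assumes "\<And>x. x \<in> vars {a} \<Longrightarrow> v x = v' x"
  shows "atom_val M v a = atom_val M v' a"
proof -
  have *: "tm_val M v t = tm_val M v' t" if "t \<in> atom_tms a" for t
    using that assms by (intro tm_val_cong) (auto simp: vars_def)
  show ?thesis
  proof (cases a)
    case (Pred p ts)
    then have "map (tm_val M v) ts = map (tm_val M v') ts" using * by auto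
    then show ?thesis using Pred by (simp only: atom_val.simps)
  qed (use * in simp)
qed

lemma tm_val_dom_update: "tm_val (M\<lparr>dom := D\<rparr>) v = tm_val M v"
proof
  show "tm_val (M\<lparr>dom := D\<rparr>) v t = tm_val M v t" for t by (induction t) (auto cong: map_cong)
qed

lemma atom_val_dom_update: "atom_val (M\<lparr>dom := D\<rparr>) v a = atom_val M v a"
  by (cases a) (simp_all add: tm_val_dom_update)

lemma holds_cong: "(\<And>x. x \<in> free_vars p \<Longrightarrow> v x = v' x) \<Longrightarrow> holds M v p = holds M v' p"
proof (induction p arbitrary: v v')
  case (Atom a)
  then have "atom_val M v a = atom_val M v' a" by (intro atom_val_cong) simp
  then show ?case by simp
next
  case (All x p)
  have "holds M (v(x := u)) p = holds M (v'(x := u)) p" for u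
    using All.prems by (intro All.IH) auto
  then show ?case by simp
next
  case (Ex x p)
  have "holds M (v(x := u)) p = holds M (v'(x := u)) p" for u
    using Ex.prems by (intro Ex.IH) auto
  then show ?case by simp
next
  case (Neg p)
  show ?case using Neg.prems Neg.IH[of v v'] by simp
next
  case (Con p q)
  show ?case using Con.prems Con.IH(1)[of v v'] Con.IH(2)[of v v'] by simp
next
  case (Dis p q)
  show ?case using Dis.prems Dis.IH(1)[of v v'] Dis.IH(2)[of v v'] by simp
next
  case (Imp p q)
  show ?case using Imp.prems Imp.IH(1)[of v v'] Imp.IH(2)[of v v'] by simp
next
  case (Iff p q)
  show ?case using Iff.prems Iff.IH(1)[of v v'] Iff.IH(2)[of v v'] by simp
qed

lemma prod_encode_mono: "a \<le> a' \<Longrightarrow> b \<le> b' \<Longrightarrow> prod_encode (a, b) \<le> prod_encode (a', b')"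
proof -
  assume "a \<le> a'" "b \<le> b'"
  moreover have "triangle i \<le> triangle j" if "i \<le> j" for i j
    using that by (rule lift_Suc_mono_le[rotated]) simp
  ultimately show ?thesis by (simp add: prod_encode_def add_mono)
qed

text \<open>Every compound formula has a positive tag, so the codes of its immediate subformulas are
  strictly smaller.\<close>

lemma less_prod_encode: "0 < a \<Longrightarrow> b < prod_encode (a, b)"
proof -
  assume "0 < a"
  moreover have "n \<le> triangle n" for n by (induction n) auto
  from this[of "a + b"] have "a + b + a \<le> prod_encode (a, b)" by (simp add: prod_encode_def)
  ultimately show ?thesis by simp
qed

lemma le_prod_encode_nested:
  "b \<le> prod_encode (a, prod_encode (b, d))" "d \<le> prod_encode (a, prod_encode (b, d))"
  using le_prod_encode_1 le_prod_encode_2 order_trans by blast+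

lemma list_encode_eq_0_iff [simp]: "list_encode xs = 0 \<longleftrightarrow> xs = []"
  by (cases xs) auto

lemma member_le_list_encode: "x \<in> set xs \<Longrightarrow> x \<le> list_encode xs"
proof (induction xs)
  case (Cons y xs)
  then show ?case
    using le_prod_encode_1[of y "list_encode xs"] le_prod_encode_2[of "list_encode xs" y] by auto
qed simp

lemma length_le_list_encode: "length xs \<le> list_encode xs"
proof (induction xs)
  case (Cons y xs)
  then show ?case using le_prod_encode_2[of "list_encode xs" y] by simp
qed simp

lemma list_encode_le_list_bound:
  "set us \<subseteq> {..n} \<Longrightarrow> length us \<le> k \<Longrightarrow> list_encode us \<le> list_bound n k"
proof (induction us arbitrary: k)
  case (Cons u us)
  then obtain j where "k = Suc j" by (cases k) auto
  with Cons show ?case by (auto intro!: prod_encode_mono)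
qed simp

lemma list_drop_list_encode: "list_drop i (list_encode xs) = list_encode (drop i xs)"
proof (induction i)
  case (Suc i)
  have "psnd (list_encode ys - 1) = list_encode (tl ys)" for ys
  proof (cases ys)
    case Nil
    have "prod_decode 0 = (0, 0)" by (simp add: prod_decode_def prod_decode_aux.simps)
    with Nil show ?thesis by simp
  qed simp
  then show ?case using Suc by (simp add: drop_Suc tl_drop)
qed simp

lemma hd_list_encode_drop:
  assumes "i < length xs"
  shows "pfst (list_encode (drop i xs) - Suc 0) = xs ! i"
  using Cons_nth_drop_Suc[OF assms, symmetric] by simp

definition function_free :: "fm \<Rightarrow> bool" where
  "function_free p \<longleftrightarrow> (\<forall>a\<in>atoms p. \<forall>t\<in>atom_tms a. var_or_const t)"

lemma atom_code_le_fm_code: "a \<in> atoms p \<Longrightarrow> atom_code a \<le> fm_code p"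
  by (induction p)
    (auto intro: le_prod_encode_2 order_trans[OF _ le_prod_encode_2]
       order_trans[OF _ le_prod_encode_nested(1)] order_trans[OF _ le_prod_encode_nested(2)])

lemma tm_code_le_atom_code: "t \<in> atom_tms a \<Longrightarrow> tm_code t \<le> atom_code a"
proof (cases a)
  case (Pred p ts)
  assume "t \<in> atom_tms a"
  then have "tm_code t \<le> list_encode (map tm_code ts)"
    using Pred by (intro member_le_list_encode) auto
  also have "\<dots> \<le> atom_code a"
    by (simp add: Pred le_prod_encode_nested)
  finally show ?thesis .
next
  case (Eq s t')
  assume "t \<in> atom_tms a"
  then show ?thesis using Eq by (auto simp: le_prod_encode_nested)
qed

lemma pred_code_le:
  "p \<le> atom_code (Pred p ts)" "length ts \<le> atom_code (Pred p ts)"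
proof -
  show "p \<le> atom_code (Pred p ts)"
    by (simp add: le_prod_encode_nested)
  have "length ts \<le> list_encode (map tm_code ts)" using length_le_list_encode[of "map tm_code ts"] by simp
  also have "\<dots> \<le> atom_code (Pred p ts)"
    by (simp add: le_prod_encode_nested)
  finally show "length ts \<le> atom_code (Pred p ts)" .
qed

lemma var_le_fm_code:
  assumes "function_free p" "x \<in> vars (atoms p)"
  shows "x \<le> fm_code p"
proof -
  obtain a t where at: "a \<in> atoms p" "t \<in> atom_tms a" "x \<in> tm_vars t"
    using assms(2) by (auto simp: vars_def)
  then have "var_or_const t" using assms(1) by (auto simp: function_free_def)
  then have "t = Var x" using at(3) by (cases t) auto
  then have "x \<le> tm_code t" by (simp add: le_prod_encode_2)
  with at tm_code_le_atom_code atom_code_le_fm_code show ?thesis by (meson order_trans)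
qed

lemma const_le_atom_code: "Fun f ts \<in> atom_tms a \<Longrightarrow> f \<le> atom_code a"
proof -
  assume "Fun f ts \<in> atom_tms a"
  moreover have "f \<le> tm_code (Fun f ts)"
    by (simp add: le_prod_encode_nested)
  ultimately show ?thesis using tm_code_le_atom_code order_trans by blast
qed

section \<open>Digits as assignments, and correctness of the truth table\<close>

lemma digit_less: "0 < n \<Longrightarrow> digit n e i < n"
  by (simp add: digit_def)

text \<open>Hence two codes below \<open>n ^ Suc c\<close> that agree on the digits up to
  \<open>c\<close> give the same assignment to all variables.\<close>

lemma digit_above:
  assumes "0 < n" "e < n ^ m" "m \<le> i"
  shows "digit n e i = 0"
proof -
  have "n ^ m \<le> n ^ i" using assms by (intro power_increasing) auto
  then show ?thesis using assms(2) by (simp add: digit_def)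
qed

lemma ex_digits:
  assumes "\<And>i. i < m \<Longrightarrow> g i < n"
  shows "\<exists>e<n ^ m. \<forall>i<m. digit n e i = g i"
  using assms
proof (induction m arbitrary: g)
  case (Suc m)
  obtain e where e: "e < n ^ m" "\<And>i. i < m \<Longrightarrow> digit n e i = g (Suc i)"
    using Suc.IH[of "\<lambda>i. g (Suc i)"] Suc.prems by auto
  have g0: "g 0 < n" using Suc.prems by simp
  define e' where "e' = g 0 + n * e"
  have "e' < n * Suc e" using g0 by (simp add: e'_def)
  also have "\<dots> \<le> n ^ Suc m" using e(1) by (simp del: mult_Suc_right)
  finally have "e' < n ^ Suc m" .
  moreover have "digit n e' i = g i" if "i < Suc m" for i
  proof (cases i)
    case 0
    then show ?thesis using g0 by (simp add: digit_def e'_def)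
  next
    case (Suc j)
    have "e' div n ^ i = e' div n div n ^ j" by (simp add: Suc div_mult2_eq)
    also have "e' div n = e" using g0 by (simp add: e'_def)
    finally show ?thesis using e(2)[of j] that Suc by (simp add: digit_def)
  qed
  ultimately show ?case by blast
qed simp

text \<open>Links the digit comparison in the quantifier clauses to a genuine update of the
  assignment: digits above \<open>c\<close> vanish on both sides, and \<open>x \<le> c\<close>
  leaves room for the new value.\<close>

lemma ex_digit_upd_iff:
  assumes n: "0 < n" and e: "e < n ^ Suc c" and x: "x \<le> c"
  shows "(\<exists>e'<n ^ Suc c. (\<forall>i<Suc c. i \<noteq> x \<longrightarrow> digit n e' i = digit n e i) \<and> Q (digit n e')) \<longleftrightarrow>
    (\<exists>u\<in>{..<n}. Q ((digit n e)(x := u)))" (is "?L \<longleftrightarrow> ?R")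
proof
  assume ?L
  then obtain e' where e': "e' < n ^ Suc c" "\<And>i. i < Suc c \<Longrightarrow> i \<noteq> x \<Longrightarrow> digit n e' i = digit n e i"
    "Q (digit n e')" by blast
  have "digit n e' i = ((digit n e)(x := digit n e' x)) i" for i
    using e'(2)[of i] digit_above[OF n e, of i] digit_above[OF n e'(1), of i]
    by (cases "i < Suc c") auto
  then have "digit n e' = (digit n e)(x := digit n e' x)" by blast
  with e'(3) have "Q ((digit n e)(x := digit n e' x))" by simp
  then show ?R using digit_less[OF n] by blast
next
  assume ?R
  then obtain u where u: "u < n" "Q ((digit n e)(x := u))" by auto
  have "((digit n e)(x := u)) i < n" for i using u(1) digit_less[OF n] by simp
  from ex_digits[of "Suc c" "(digit n e)(x := u)" n, OF this]
  obtain e' where e': "e' < n ^ Suc c" "\<And>i. i < Suc c \<Longrightarrow> digit n e' i = ((digit n e)(x := u)) i"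
    by blast
  have "digit n e' i = ((digit n e)(x := u)) i" for i
    using e'(2)[of i] digit_above[OF n e, of i] digit_above[OF n e'(1), of i] x
    by (cases "i < Suc c") auto
  then have "digit n e' = (digit n e)(x := u)" by blast
  with u(2) e' show ?L by auto
qed

lemma tm_value_tm_code:
  "var_or_const t \<Longrightarrow> tm_value n K e (tm_code t) = tm_val (struct_of n K R) (digit n e) t"
  by (cases t) (auto simp: tm_value_def struct_of_def)

lemma args_match_iff:
  assumes "\<forall>t\<in>set ts. var_or_const t"
  shows "args_match n K e (list_encode (map tm_code ts)) (list_encode us) \<longleftrightarrow>
    us = map (tm_val (struct_of n K R) (digit n e)) ts" (is "?L \<longleftrightarrow> ?R")
proof
  assume ?R
  then show ?L using assms
    by (auto simp: args_match_def list_drop_list_encode hd_list_encode_drop tm_value_tm_code[where R = R])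
next
  assume ?L
  have len: "length ts \<le> list_encode (map tm_code ts)"
    using length_le_list_encode[of "map tm_code ts"] by simp
  have L: "(length ts \<le> i) = (length us \<le> i) \<and> (i < length ts \<longrightarrow>
      pfst (list_encode (drop i us) - Suc 0) =
       tm_value n K e (pfst (list_encode (drop i (map tm_code ts)) - Suc 0)))"
    if "i \<le> length ts" for i
  proof -
    have "i < Suc (list_encode (map tm_code ts))" using that len by simp
    from \<open>?L\<close>[unfolded args_match_def, rule_format, OF this] show ?thesis
      by (simp add: list_drop_list_encode not_le)
  qed
  \<comment> \<open>The emptiness test at the end of \<open>ts\<close> bounds the length of
    \<open>us\<close>; only then is the end of \<open>us\<close> within range for the converse
    test.\<close>
  have "length us \<le> length ts" using L[of "length ts"] by simp
  then have eq: "length us = length ts" using L[of "length us"] by simp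
  show ?R
  proof (rule nth_equalityI)
    fix i assume i: "i < length us"
    then have "us ! i = tm_value n K e (map tm_code ts ! i)"
      using L[of i] eq hd_list_encode_drop[of i us] hd_list_encode_drop[of i "map tm_code ts"] by simp
    then show "us ! i = map (tm_val (struct_of n K R) (digit n e)) ts ! i"
      using i eq assms by (simp add: tm_value_tm_code[where R = R])
  qed (simp add: eq)
qed

lemma set_decode_less: "q \<in> set_decode R \<Longrightarrow> q < R"
proof -
  assume "q \<in> set_decode R"
  then have "0 < R div 2 ^ q" unfolding set_decode_def by (intro odd_pos) simp
  then have "2 ^ q \<le> R" by (simp add: div_greater_zero_iff)
  with less_exp show ?thesis by (rule order.strict_trans2)
qed

lemma atom_true_atom_code:
  assumes "\<forall>t\<in>atom_tms a. var_or_const t"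
  shows "atom_true n K R e (atom_code a) \<longleftrightarrow> atom_val (struct_of n K R) (digit n e) a"
proof (cases a)
  case (Pred p ts)
  let ?us = "map (tm_val (struct_of n K R) (digit n e)) ts"
  have match: "args_match n K e (list_encode (map tm_code ts)) (list_encode us) \<longleftrightarrow> us = ?us" for us
    using assms Pred by (intro args_match_iff) simp
  have "(\<exists>q<R. q \<in> set_decode R \<and> pfst q = p \<and>
      args_match n K e (list_encode (map tm_code ts)) (psnd q)) \<longleftrightarrow>
    prod_encode (p, list_encode ?us) \<in> set_decode R" (is "?L \<longleftrightarrow> ?R")
  proof
    assume ?L
    then obtain q where q: "q \<in> set_decode R" "pfst q = p"
      "args_match n K e (list_encode (map tm_code ts)) (psnd q)" by blast
    have "psnd q = list_encode (list_decode (psnd q))" by simp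
    with q(3) have "list_decode (psnd q) = ?us"
      using match[of "list_decode (psnd q)"] by simp
    then have "psnd q = list_encode ?us" using list_decode_inverse[of "psnd q"] by simp
    with q(2) have "q = prod_encode (p, list_encode ?us)" using prod_encode_pfst_psnd[of q] by simp
    with q(1) show ?R by simp
  next
    assume ?R
    then show ?L using match[of ?us]
      by (intro exI[of _ "prod_encode (p, list_encode ?us)"]) (auto intro: set_decode_less)
  qed
  then show ?thesis by (simp add: Pred atom_true_def struct_of_def)
next
  case (Eq s t)
  then show ?thesis using assms by (simp add: atom_true_def tm_value_tm_code[where R = R])
qed

text \<open>Bit \<open>j\<close> is decided once, from the table below \<open>j\<close>; later steps
  add only higher powers of two.\<close>

lemma set_decode_truth_table:
  "j \<in> set_decode (truth_table c n K R k) \<longleftrightarrow>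
   j < k \<and> truth_clause c n K R (n ^ Suc c) (j mod n ^ Suc c) (j div n ^ Suc c) (truth_table c n K R j)"
proof (induction k arbitrary: j)
  case (Suc k)
  then have "k \<notin> set_decode (truth_table c n K R k)" by simp
  from set_decode_plus_power_2[OF this] Suc show ?case
    by (auto simp: add.commute less_Suc_eq simp del: power_Suc)
qed simp

text \<open>\<open>m\<close> is generalized because the induction hypothesis is applied to the
  shorter table present when the bit of the compound formula is decided.\<close>

lemma truth_table_fm_code:
  assumes n: "0 < n"
  shows "function_free p \<Longrightarrow> fm_code p \<le> c \<Longrightarrow> e < n ^ Suc c \<Longrightarrow> n ^ Suc c * fm_code p + e < m \<Longrightarrow>
    n ^ Suc c * fm_code p + e \<in> set_decode (truth_table c n K R m) \<longleftrightarrow>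
    holds (struct_of n K R) (digit n e) p"
proof (induction p arbitrary: e m)
  define E where "E = n ^ Suc c"
  define t where "t k = set_decode (truth_table c n K R k)" for k
  have unfold: "E * fm_code p + e \<in> t m \<longleftrightarrow>
      truth_clause c n K R E e (fm_code p) (truth_table c n K R (E * fm_code p + e))"
    if "e < E" "E * fm_code p + e < m" for p e m
    using that unfolding t_def set_decode_truth_table E_def[symmetric] by simp
  \<comment> \<open>Positions are ordered lexicographically, so a smaller formula code precedes a
    larger one under whatever assignments.\<close>
  have pos: "E * a + e' < E * b + e" if "a < b" "e' < E" for a b e e'
  proof -
    have "E * a + e' < E * Suc a" using that(2) by simp
    also have "\<dots> \<le> E * b" using that(1) by (intro mult_le_mono2) simp
    finally show ?thesis by simp
  qed
  note defs = E_def[symmetric] t_def[symmetric]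
  note le = le_prod_encode_1 le_prod_encode_2
  note code_less = le_less_trans[OF _ less_prod_encode] le
  {
    case (Atom a)
    then show ?case
      using unfold[of e "Atom a" m] atom_true_atom_code[of a n K R e]
      unfolding defs by (simp add: truth_clause_def function_free_def)
  next
    case (Neg p)
    have "fm_code p < fm_code (Neg p)" by (simp add: less_prod_encode)
    with Neg pos show ?case
      using unfold[of e "Neg p" m]
      unfolding defs by (simp add: truth_clause_def function_free_def ball_Un t_def)
  next
    case (Con p q)
    have "fm_code p < fm_code (Con p q)" "fm_code q < fm_code (Con p q)"
      by (auto intro: code_less)
    with Con pos show ?case
      using unfold[of e "Con p q" m]
      unfolding defs by (simp add: truth_clause_def function_free_def ball_Un t_def)
  next
    case (Dis p q)
    have "fm_code p < fm_code (Dis p q)" "fm_code q < fm_code (Dis p q)"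
      by (auto intro: code_less)
    with Dis pos show ?case
      using unfold[of e "Dis p q" m]
      unfolding defs by (simp add: truth_clause_def function_free_def ball_Un t_def)
  next
    case (Imp p q)
    have "fm_code p < fm_code (Imp p q)" "fm_code q < fm_code (Imp p q)"
      by (auto intro: code_less)
    with Imp pos show ?case
      using unfold[of e "Imp p q" m]
      unfolding defs by (simp add: truth_clause_def function_free_def ball_Un t_def)
  next
    case (Iff p q)
    have "fm_code p < fm_code (Iff p q)" "fm_code q < fm_code (Iff p q)"
      by (auto intro: code_less)
    with Iff pos show ?case
      using unfold[of e "Iff p q" m]
      unfolding defs by (simp add: truth_clause_def function_free_def ball_Un t_def)
  next
    case (All x p)
    have less: "fm_code p < fm_code (All x p)" by (auto intro: code_less)
    have x: "x \<le> c"
      using All.prems(2) by (auto intro: order_trans[OF order_trans[OF le(1) le(2)]])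
    have ih: "E * fm_code p + e' \<in> t (E * fm_code (All x p) + e) \<longleftrightarrow>
        holds (struct_of n K R) (digit n e') p" if "e' < E" for e'
      using All.IH[of e' "E * fm_code (All x p) + e"] All.prems less pos[OF less that] that
      unfolding defs by (simp add: function_free_def)
    have "E * fm_code (All x p) + e \<in> t m \<longleftrightarrow>
        \<not> (\<exists>e'<E. (\<forall>i<Suc c. i \<noteq> x \<longrightarrow> digit n e' i = digit n e i) \<and>
          \<not> E * fm_code p + e' \<in> t (E * fm_code (All x p) + e))"
      using All.prems unfold[of e "All x p" m] unfolding defs
      by (simp add: truth_clause_def t_def) blast
    also have "\<dots> \<longleftrightarrow> \<not> (\<exists>e'<E. (\<forall>i<Suc c. i \<noteq> x \<longrightarrow> digit n e' i = digit n e i) \<and>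
          \<not> holds (struct_of n K R) (digit n e') p)"
      using ih by blast
    also have "\<dots> \<longleftrightarrow> holds (struct_of n K R) (digit n e) (All x p)"
      using ex_digit_upd_iff[OF n All.prems(3) x, of "\<lambda>v. \<not> holds (struct_of n K R) v p"]
      unfolding defs by (simp add: struct_of_def)
    finally show ?case unfolding defs .
  next
    case (Ex x p)
    have less: "fm_code p < fm_code (Ex x p)" by (auto intro: code_less)
    have x: "x \<le> c"
      using Ex.prems(2) by (auto intro: order_trans[OF order_trans[OF le(1) le(2)]])
    have ih: "E * fm_code p + e' \<in> t (E * fm_code (Ex x p) + e) \<longleftrightarrow>
        holds (struct_of n K R) (digit n e') p" if "e' < E" for e'
      using Ex.IH[of e' "E * fm_code (Ex x p) + e"] Ex.prems less pos[OF less that] that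
      unfolding defs by (simp add: function_free_def)
    have "E * fm_code (Ex x p) + e \<in> t m \<longleftrightarrow>
        (\<exists>e'<E. (\<forall>i<Suc c. i \<noteq> x \<longrightarrow> digit n e' i = digit n e i) \<and>
          E * fm_code p + e' \<in> t (E * fm_code (Ex x p) + e))"
      using Ex.prems unfold[of e "Ex x p" m] unfolding defs
      by (simp add: truth_clause_def t_def)
    also have "\<dots> \<longleftrightarrow> (\<exists>e'<E. (\<forall>i<Suc c. i \<noteq> x \<longrightarrow> digit n e' i = digit n e i) \<and>
          holds (struct_of n K R) (digit n e') p)"
      using ih by blast
    also have "\<dots> \<longleftrightarrow> holds (struct_of n K R) (digit n e) (Ex x p)"
      using ex_digit_upd_iff[OF n Ex.prems(3) x, of "\<lambda>v. holds (struct_of n K R) v p"]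
      unfolding defs by (simp add: struct_of_def)
    finally show ?case unfolding defs .
  }
qed

lemma has_small_model_iff:
  assumes "function_free \<phi>" and c: "c = fm_code \<phi>"
  shows "has_small_model c \<longleftrightarrow> (\<exists>n K R. 0 < n \<and> n \<le> size_bound c \<and> K < n ^ Suc c \<and>
    R < 2 ^ Suc (prod_encode (c, list_bound (size_bound c) c)) \<and>
    holds (struct_of n K R) (digit n 0) \<phi>)"
proof -
  have "n ^ Suc c * c \<in> set_decode (truth_table c n K R (Suc (n ^ Suc c * c))) \<longleftrightarrow>
      holds (struct_of n K R) (digit n 0) \<phi>" if "0 < n" for n K R
    using truth_table_fm_code[OF that assms(1), of c 0 "Suc (n ^ Suc c * c)" K R] that
    by (simp add: c)
  then show ?thesis
    unfolding has_small_model_def less_Suc_eq_le neq0_conv by blast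
qed

lemma has_model_of_has_small_model:
  assumes "function_free \<phi>" "sentence \<phi>" "has_small_model (fm_code \<phi>)"
  shows "has_model TYPE(nat) \<phi>"
proof -
  obtain n K R where n: "0 < n" and h: "holds (struct_of n K R) (digit n 0) \<phi>"
    using assms(3) has_small_model_iff[OF assms(1) refl] by blast
  have "is_struct (struct_of n K R)"
    using n digit_less[OF n] by (auto simp: is_struct_def struct_of_def lessThan_empty_iff)
  moreover have "holds (struct_of n K R) v \<phi>" for v
    using h holds_cong[of \<phi> v "digit n 0"] assms(2) by (simp add: sentence_def)
  ultimately show ?thesis unfolding has_model_def models_def by blast
qed

section \<open>A bounded set of witnesses for the existential player\<close>

definition quantify1 :: "(bool \<times> nat) list \<Rightarrow> fm \<Rightarrow> fm" where
  "quantify1 qs \<psi> = foldr (\<lambda>(b, x). if b then All x else Ex x) qs \<psi>"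

lemma quantify1_simps [simp]:
  "quantify1 [] \<psi> = \<psi>"
  "quantify1 ((True, x) # qs) \<psi> = All x (quantify1 qs \<psi>)"
  "quantify1 ((False, x) # qs) \<psi> = Ex x (quantify1 qs \<psi>)"
  by (simp_all add: quantify1_def)

text \<open>An existential variable of \<open>S\<close> still to be chosen means that no universal variable of \<open>S\<close> has
  been chosen yet, so the position carries no information about \<open>S\<close>, hence the value 0.\<close>

fun fingerprint :: "'u struct \<Rightarrow> atom set \<Rightarrow> (bool \<times> nat) list \<Rightarrow> (nat \<Rightarrow> 'u) \<Rightarrow> nat" where
  "fingerprint M S [] v = set_encode (atom_code ` {a\<in>S. atom_val M v a})"
| "fingerprint M S ((b, x) # qs) v =
     (if b then set_encode ((\<lambda>u. fingerprint M S qs (v(x := u))) ` dom M)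
      else if x \<in> vars S then 0 else fingerprint M S qs v)"

text \<open>Universal variables of the suffix are overwritten, and an existential one in
  \<open>vars S\<close> cuts the value to 0, so only variables fixed before the suffix
  matter.\<close>

lemma fingerprint_cong:
  "(\<And>x. x \<in> vars S - snd ` set qs \<Longrightarrow> v x = v' x) \<Longrightarrow> fingerprint M S qs v = fingerprint M S qs v'"
proof (induction qs arbitrary: v v')
  case Nil
  have "atom_val M v a = atom_val M v' a" if "a \<in> S" for a
    using that Nil by (intro atom_val_cong) (auto simp: vars_def)
  then have "{a \<in> S. atom_val M v a} = {a \<in> S. atom_val M v' a}" by auto
  then show ?case by simp
next
  case (Cons q qs)
  obtain b x where q: "q = (b, x)" by (cases q)
  have "fingerprint M S qs (v(x := u)) = fingerprint M S qs (v'(x := u))" for u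
    using Cons.prems by (intro Cons.IH) (auto simp: q)
  moreover have "fingerprint M S qs v = fingerprint M S qs v'" if "x \<notin> vars S"
    using Cons.prems that by (intro Cons.IH) (auto simp: q)
  ultimately show ?case by (simp add: q)
qed

lemma set_encode_less:
  assumes "A \<subseteq> {..<n}"
  shows "set_encode A < 2 ^ n"
proof -
  have "set_encode A \<le> (\<Sum>i<n. 2 ^ i)"
    unfolding set_encode_def using assms by (intro sum_mono2) auto
  also have "\<dots> < 2 ^ n" by (induction n) auto
  finally show ?thesis .
qed

text \<open>A universal quantifier passes to sets of fingerprints and so exponentiates the bound; an
  existential one does not raise the value.\<close>

lemma fingerprint_less:
  assumes "\<And>a. a \<in> S \<Longrightarrow> atom_code a \<le> c"
  shows "fingerprint M S qs v < fp_bound c (length qs)"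
proof (induction qs arbitrary: v)
  case Nil
  have "atom_code ` {a \<in> S. atom_val M v a} \<subseteq> {..<Suc c}"
    using assms by (auto simp: less_Suc_eq_le)
  from set_encode_less[OF this] show ?case by (simp del: power_Suc)
next
  case (Cons q qs)
  obtain b x where q: "q = (b, x)" by (cases q)
  have "set_encode ((\<lambda>u. fingerprint M S qs (v(x := u))) ` dom M) < 2 ^ fp_bound c (length qs)"
    using Cons.IH by (intro set_encode_less) auto
  moreover have "fingerprint M S qs v < 2 ^ fp_bound c (length qs)"
    using Cons.IH[of v] less_exp by (rule order.strict_trans)
  ultimately show ?case by (auto simp: q)
qed

lemma fp_bound_mono: "i \<le> j \<Longrightarrow> fp_bound c i \<le> fp_bound c j"
  by (rule lift_Suc_mono_le) (simp_all add: less_exp less_imp_le)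

lemma growth_ge: "d \<le> growth c d"
  by (simp add: growth_def)

lemma growth_mono: "d \<le> d' \<Longrightarrow> growth c d \<le> growth c d'"
  unfolding growth_def by (intro add_mono mult_mono power_mono) auto

lemma growth_funpow_mono:
  assumes "d \<le> d'" "i \<le> j"
  shows "(growth c ^^ i) d \<le> (growth c ^^ j) d'"
proof -
  have "(growth c ^^ i) d \<le> (growth c ^^ i) d'"
    using assms(1) by (induction i) (auto intro: growth_mono)
  also have "\<dots> \<le> (growth c ^^ j) d'"
    by (rule lift_Suc_mono_le[of "\<lambda>i. (growth c ^^ i) d'", OF _ assms(2)]) (simp add: growth_ge)
  finally show ?thesis .
qed

fun qfree :: "fm \<Rightarrow> bool" where
  "qfree (Atom a) = True"
| "qfree (Neg p) = qfree p"
| "qfree (Con p q) = (qfree p \<and> qfree q)"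
| "qfree (Dis p q) = (qfree p \<and> qfree q)"
| "qfree (Imp p q) = (qfree p \<and> qfree q)"
| "qfree (Iff p q) = (qfree p \<and> qfree q)"
| "qfree (All x p) = False"
| "qfree (Ex x p) = False"

lemma holds_qfree_cong:
  assumes "qfree \<psi>" "\<And>a. a \<in> atoms \<psi> \<Longrightarrow> atom_val M v a = atom_val M' v' a"
  shows "holds M v \<psi> = holds M' v' \<psi>"
  using assms by (induction \<psi>) auto

lemma finite_atoms: "finite (atoms p)"
  by (induction p) auto

text \<open>The GBSR condition for a prefix written as a list of single quantifiers, where \<open>True\<close> marks the
  universal ones and \<open>cl\<close> assigns to each atom the index of its part of the partition.\<close>

locale separated_prefix =
  fixes qs :: "(bool \<times> nat) list" and \<psi> :: fm and cl :: "atom \<Rightarrow> nat" and M :: "'u struct"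
    and c :: nat
  assumes qfree: "qfree \<psi>"
    and distinct_qs: "distinct (map snd qs)"
    and closed: "vars (atoms \<psi>) \<subseteq> snd ` set qs"
    and order: "\<And>ps rs y x i. qs = ps @ (False, y) # rs \<Longrightarrow> y \<in> vars {a\<in>atoms \<psi>. cl a = i} \<Longrightarrow>
      (True, x) \<in> set ps \<Longrightarrow> x \<notin> vars {a\<in>atoms \<psi>. cl a = i}"
    and separated: "\<And>x i j. (True, x) \<in> set qs \<Longrightarrow> x \<in> vars {a\<in>atoms \<psi>. cl a = i} \<Longrightarrow>
      x \<in> vars {a\<in>atoms \<psi>. cl a = j} \<Longrightarrow> i = j"
    and code_le: "\<And>a. a \<in> atoms \<psi> \<Longrightarrow> atom_code a \<le> c"
    and var_le: "\<And>x. x \<in> snd ` set qs \<Longrightarrow> x \<le> c"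
begin

abbreviation part :: "nat \<Rightarrow> atom set" where
  "part i \<equiv> {a\<in>atoms \<psi>. cl a = i}"

text \<open>The information on which an existential answer may depend: universal values enter only
  through the fingerprints.\<close>

definition equivalent :: "(bool \<times> nat) list \<Rightarrow> (bool \<times> nat) list \<Rightarrow> (nat \<Rightarrow> 'u) \<Rightarrow> (nat \<Rightarrow> 'u) \<Rightarrow> bool"
  where "equivalent ps rs v v' \<longleftrightarrow> (\<forall>y. (False, y) \<in> set ps \<longrightarrow> v y = v' y) \<and>
    (\<forall>i. fingerprint M (part i) rs v = fingerprint M (part i) rs v')"

text \<open>\<open>dom M\<close> may be infinite, while \<open>set_encode\<close> is injective on
  finite sets only.\<close>

lemma finite_fingerprints: "finite ((\<lambda>u. fingerprint M (part i) rs (v(x := u))) ` dom M)"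
  by (rule finite_subset[of _ "{..<fp_bound c (length rs)}"])
    (auto intro: fingerprint_less code_le)

lemma fingerprint_upd: "x \<notin> vars (part i) \<Longrightarrow>
    fingerprint M (part i) rs (v(x := u)) = fingerprint M (part i) rs v"
  by (rule fingerprint_cong) auto

text \<open>If \<open>y\<close> occurs in part \<open>i\<close>, then by \<open>order\<close> all
  variables of that part chosen so far are existential, and \<open>v\<close> and \<open>v'\<close>
  agree on them. Otherwise the choice of \<open>y\<close> leaves the fingerprint of the part
  unchanged.\<close>

lemma equivalent_Ex:
  assumes qs: "qs = ps @ (False, y) # rs" and eq: "equivalent ps ((False, y) # rs) v v'"
  shows "equivalent (ps @ [(False, y)]) rs (v(y := w)) (v'(y := w))"
  unfolding equivalent_def
proof (intro conjI allI impI)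
  fix i
  show "fingerprint M (part i) rs (v(y := w)) = fingerprint M (part i) rs (v'(y := w))"
  proof (cases "y \<in> vars (part i)")
    case True
    show ?thesis
    proof (rule fingerprint_cong)
      fix z assume z: "z \<in> vars (part i) - snd ` set rs"
      then have "z \<in> snd ` set qs" using closed by (auto simp: vars_def)
      then consider "z = y" | b where "(b, z) \<in> set ps" using z by (auto simp: qs)
      then show "(v(y := w)) z = (v'(y := w)) z"
      proof cases
        case 2
        then show ?thesis
          using order[OF qs True] z eq by (cases b) (auto simp: equivalent_def)
      qed simp
    qed
  next
    case False
    then show ?thesis
      using eq unfolding fingerprint_upd[OF False] by (auto simp: equivalent_def dest: spec[of _ i])
  qed
qed (use eq in \<open>auto simp: equivalent_def\<close>)

text \<open>By \<open>separated\<close> at most one part contains \<open>x\<close>. Equal sets of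
  reachable fingerprints for that part yield a move \<open>u0\<close> matching \<open>u\<close>, and
  no other part notices either move.\<close>

lemma equivalent_All:
  assumes qs: "qs = ps @ (True, x) # rs" and eq: "equivalent ps ((True, x) # rs) v v'"
    and u: "u \<in> dom M"
  obtains u0 where "u0 \<in> dom M" "equivalent (ps @ [(True, x)]) rs (v(x := u0)) (v'(x := u))"
proof -
  have img: "(\<lambda>u. fingerprint M (part i) rs (v(x := u))) ` dom M =
      (\<lambda>u. fingerprint M (part i) rs (v'(x := u))) ` dom M" for i
    using eq set_encode_eq[OF finite_fingerprints finite_fingerprints]
    by (auto simp: equivalent_def)
  have x: "(False, x) \<notin> set ps" using distinct_qs by (force simp: qs)
  \<comment> \<open>Without \<open>x\<close> in the part both images in \<open>img\<close> are
    singletons.\<close>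
  have other: "fingerprint M (part j) rs (v(x := u0)) = fingerprint M (part j) rs (v'(x := u))"
    if "x \<notin> vars (part j)" for j u0
    using img[of j] u unfolding fingerprint_upd[OF that] by auto
  obtain u0 where u0: "u0 \<in> dom M"
    "\<And>i. x \<in> vars (part i) \<Longrightarrow>
      fingerprint M (part i) rs (v(x := u0)) = fingerprint M (part i) rs (v'(x := u))"
  proof (cases "\<exists>i. x \<in> vars (part i)")
    case True
    then obtain i where i: "x \<in> vars (part i)" by blast
    have "fingerprint M (part i) rs (v'(x := u)) \<in> (\<lambda>u. fingerprint M (part i) rs (v(x := u))) ` dom M"
      unfolding img using u by blast
    then obtain u0 where "u0 \<in> dom M"
      "fingerprint M (part i) rs (v(x := u0)) = fingerprint M (part i) rs (v'(x := u))"
      by auto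
    moreover have "j = i" if "x \<in> vars (part j)" for j
      using separated[OF _ that i] by (simp add: qs)
    ultimately show ?thesis using that by metis
  qed (use that u in blast)
  have "fingerprint M (part i) rs (v(x := u0)) = fingerprint M (part i) rs (v'(x := u))" for i
    using other u0(2) by blast
  moreover have "(v(x := u0)) y = (v'(x := u)) y" if "(False, y) \<in> set (ps @ [(True, x)])" for y
    using that eq x by (auto simp: equivalent_def)
  ultimately show ?thesis using that u0(1) unfolding equivalent_def by blast
qed

text \<open>Each universal move against \<open>v'\<close> is pulled back to one against
  \<open>v\<close>, and each answer at \<open>v\<close> is copied to \<open>v'\<close>. At the end
  equal fingerprints fix the true atoms of every part.\<close>

lemma holds_equivalent:
  "qs = ps @ rs \<Longrightarrow> equivalent ps rs v v' \<Longrightarrow> holds M v (quantify1 rs \<psi>) \<Longrightarrow>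
   holds M v' (quantify1 rs \<psi>)"
proof (induction rs arbitrary: ps v v')
  case Nil
  have "atom_val M v a = atom_val M v' a" if a: "a \<in> atoms \<psi>" for a
  proof -
    have fin: "finite (atom_code ` {b \<in> part (cl a). atom_val M w b})" for w
      by (rule finite_subset[of _ "{..c}"]) (auto intro: code_le)
    have "fingerprint M (part (cl a)) [] v = fingerprint M (part (cl a)) [] v'"
      using Nil.prems(2) unfolding equivalent_def by blast
    then have "{b \<in> part (cl a). atom_val M v b} = {b \<in> part (cl a). atom_val M v' b}"
      unfolding fingerprint.simps set_encode_eq[OF fin fin] inj_image_eq_iff[OF inj_atom_code] .
    then show ?thesis using a by blast
  qed
  then have "holds M v \<psi> = holds M v' \<psi>" by (rule holds_qfree_cong[OF qfree])
  then show ?case using Nil.prems(3) by simp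
next
  case (Cons q rs)
  have IH: "equivalent (ps @ [q]) rs w w' \<Longrightarrow> holds M w (quantify1 rs \<psi>) \<Longrightarrow>
      holds M w' (quantify1 rs \<psi>)" for w w'
    using Cons.IH[of "ps @ [q]"] Cons.prems(1) by simp
  consider x where "q = (True, x)" | x where "q = (False, x)" by (cases q) auto
  then show ?case
  proof cases
    case (1 x)
    have "holds M (v'(x := u)) (quantify1 rs \<psi>)" if u: "u \<in> dom M" for u
    proof -
      obtain u0 where "u0 \<in> dom M" "equivalent (ps @ [(True, x)]) rs (v(x := u0)) (v'(x := u))"
        using equivalent_All[OF Cons.prems(1,2)[unfolded 1] u] .
      then show ?thesis using IH Cons.prems(3) by (simp add: 1)
    qed
    then show ?thesis by (simp add: 1)
  next
    case (2 x)
    from Cons.prems(3) obtain w where w: "w \<in> dom M" "holds M (v(x := w)) (quantify1 rs \<psi>)"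
      by (auto simp: 2)
    have "holds M (v'(x := w)) (quantify1 rs \<psi>)"
      by (rule IH[OF _ w(2)]) (use equivalent_Ex[OF Cons.prems(1,2)[unfolded 2]] 2 in simp)
    then show ?thesis using w(1) by (auto simp: 2)
  qed
qed

lemma length_qs_le: "length qs \<le> Suc c"
proof -
  have "set (map snd qs) \<subseteq> {..c}" using var_le by auto
  then show ?thesis
    using card_mono[of "{..c}" "set (map snd qs)"] distinct_card[OF distinct_qs] by simp
qed

text \<open>One stored answer per key suffices: if it wins at some assignment with that key,
  \<open>holds_equivalent\<close> carries the win to all of them.\<close>

lemma witnesses:
  assumes qs: "qs = ps @ (False, y) # rs" and fin: "finite D" and sub: "D \<subseteq> dom M"
    and ne: "D \<noteq> {}"
  obtains D1 where "D \<subseteq> D1" "D1 \<subseteq> dom M" "finite D1" "card D1 \<le> growth c (card D)"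
    "\<forall>v. (\<forall>z. (False, z) \<in> set ps \<longrightarrow> v z \<in> D) \<longrightarrow> holds M v (quantify1 ((False, y) # rs) \<psi>) \<longrightarrow>
       (\<exists>w\<in>D1. holds M (v(y := w)) (quantify1 rs \<psi>))"
proof -
  define Y where "Y = {z. (False, z) \<in> set ps}"
  define I where "I = cl ` atoms \<psi>"
  define B where "B = fp_bound c (Suc c)"
  define key where "key v = (restrict v Y, \<lambda>i\<in>I. fingerprint M (part i) ((False, y) # rs) v)"
    for v :: "nat \<Rightarrow> 'u"
  define keys where "keys = (Y \<rightarrow>\<^sub>E D) \<times> (I \<rightarrow>\<^sub>E {..<B})"
  define good where "good k w \<longleftrightarrow> w \<in> dom M \<and> (\<exists>v. key v = k \<and> holds M (v(y := w)) (quantify1 rs \<psi>))"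
    for k w
  define D1 where "D1 = D \<union> (\<lambda>k. SOME w. good k w) ` {k\<in>keys. \<exists>w. good k w}"

  have "z \<le> c" if "(False, z) \<in> set ps" for z
    using that by (intro var_le) (force simp: qs)
  then have "Y \<subseteq> {..c}" by (auto simp: Y_def)
  then have Y: "finite Y" "card Y \<le> Suc c"
    using finite_subset card_mono[of "{..c}" Y] by auto
  \<comment> \<open>Each nonempty part contains an atom, and distinct atoms have distinct codes up
    to \<open>c\<close>, so there are at most \<open>Suc c\<close> such parts.\<close>
  have codes: "atom_code ` atoms \<psi> \<subseteq> {..c}" using code_le by auto
  have "finite (atoms \<psi>)" by (rule finite_atoms)
  moreover have "card (atoms \<psi>) \<le> Suc c"
    using card_inj_on_le[OF inj_on_subset[OF inj_atom_code subset_UNIV] codes] by simp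
  ultimately have I: "finite I" "card I \<le> Suc c"
    unfolding I_def using card_image_le le_trans by blast+
  have "length ((False, y) # rs) \<le> Suc c" using length_qs_le by (simp add: qs)
  then have fp: "fingerprint M (part i) ((False, y) # rs) v < B" for i v
    unfolding B_def using fingerprint_less[of "part i" c] code_le fp_bound_mono
    by (metis (no_types, lifting) mem_Collect_eq order_less_le_trans)
  have "0 < B" by (simp add: B_def)

  have "card D > 0" using fin ne by (simp add: card_gt_0_iff)
  have "card keys = card D ^ card Y * B ^ card I"
    unfolding keys_def using Y I by (simp add: card_cartesian_product card_funcsetE)
  also have "\<dots> \<le> card D ^ Suc c * B ^ Suc c"
    using Y I \<open>0 < B\<close> \<open>card D > 0\<close> by (intro mult_mono power_increasing) auto
  finally have card_keys: "card keys \<le> card D ^ Suc c * B ^ Suc c" .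
  have fin_keys: "finite keys" unfolding keys_def using Y I fin by (auto intro!: finite_PiE)
  have some: "good k (SOME w. good k w)" if "\<exists>w. good k w" for k
    using that by (rule someI_ex)
  show ?thesis
  proof
    show "D \<subseteq> D1" by (simp add: D1_def)
    have "(SOME w. good k w) \<in> dom M" if "\<exists>w. good k w" for k
      using some[OF that] by (simp add: good_def)
    then show "D1 \<subseteq> dom M" using sub unfolding D1_def by blast
    show "finite D1" unfolding D1_def using fin fin_keys by simp
    have "card D1 \<le> card D + card {k\<in>keys. \<exists>w. good k w}"
      unfolding D1_def using fin_keys
      by (intro order_trans[OF card_Un_le] add_left_mono card_image_le) simp
    also have "\<dots> \<le> card D + card keys" using fin_keys by (intro add_left_mono card_mono) auto
    finally show "card D1 \<le> growth c (card D)"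
      using card_keys by (simp add: growth_def B_def)
  next
    show "\<forall>v. (\<forall>z. (False, z) \<in> set ps \<longrightarrow> v z \<in> D) \<longrightarrow> holds M v (quantify1 ((False, y) # rs) \<psi>) \<longrightarrow>
       (\<exists>w\<in>D1. holds M (v(y := w)) (quantify1 rs \<psi>))"
    proof (intro allI impI)
      fix v assume v: "\<forall>z. (False, z) \<in> set ps \<longrightarrow> v z \<in> D"
        and holds: "holds M v (quantify1 ((False, y) # rs) \<psi>)"
      then obtain w where w: "w \<in> dom M" "holds M (v(y := w)) (quantify1 rs \<psi>)" by auto
      then have ex: "\<exists>w. good (key v) w" unfolding good_def by blast
      have "key v \<in> keys" unfolding keys_def key_def using v fp by (auto simp: Y_def)
      then have mem: "(SOME w. good (key v) w) \<in> D1" unfolding D1_def using ex by blast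
      define w0 where "w0 = (SOME w. good (key v) w)"
      obtain v0 where v0: "key v0 = key v" "holds M (v0(y := w0)) (quantify1 rs \<psi>)"
        using some[OF ex] unfolding good_def w0_def by blast
      from v0(1) have keys_eq: "restrict v0 Y = restrict v Y"
        "(\<lambda>i\<in>I. fingerprint M (part i) ((False, y) # rs) v0) =
         (\<lambda>i\<in>I. fingerprint M (part i) ((False, y) # rs) v)"
        by (simp_all only: key_def prod.inject)
      have "equivalent ps ((False, y) # rs) v0 v"
        unfolding equivalent_def
      proof (intro conjI allI impI)
        show "v0 z = v z" if "(False, z) \<in> set ps" for z
          using fun_cong[OF keys_eq(1), of z] that by (simp add: Y_def)
        show "fingerprint M (part i) ((False, y) # rs) v0 = fingerprint M (part i) ((False, y) # rs) v" for i
        proof (cases "i \<in> I")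
          case True
          then show ?thesis using fun_cong[OF keys_eq(2), of i] by (simp only: restrict_apply' if_True)
        next
          case False
          \<comment> \<open>The key omits empty parts, whose fingerprints do not depend on the
            assignment.\<close>
          then have "part i = {}" by (auto simp: I_def)
          then show ?thesis by (intro fingerprint_cong) (auto simp: vars_def)
        qed
      qed
      from equivalent_Ex[OF qs this] have "equivalent (ps @ [(False, y)]) rs (v0(y := w0)) (v(y := w0))" .
      from holds_equivalent[OF _ this v0(2)] have "holds M (v(y := w0)) (quantify1 rs \<psi>)"
        by (simp add: qs)
      then show "\<exists>w\<in>D1. holds M (v(y := w)) (quantify1 rs \<psi>)" using mem w0_def by blast
    qed
  qed
qed

text \<open>Only the existential variables must take values in \<open>D\<close>. Universal values
  are unrestricted, so moves from the final, larger \<open>D'\<close> are already covered when the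
  witnesses are collected.\<close>

lemma small_domain:
  assumes "qs = ps @ rs" "finite D" "D \<subseteq> dom M" "D \<noteq> {}"
  shows "\<exists>D'. D \<subseteq> D' \<and> D' \<subseteq> dom M \<and> finite D' \<and> card D' \<le> (growth c ^^ length rs) (card D) \<and>
    (\<forall>v. (\<forall>z. (False, z) \<in> set ps \<longrightarrow> v z \<in> D) \<longrightarrow> holds M v (quantify1 rs \<psi>) \<longrightarrow>
       holds (M\<lparr>dom := D'\<rparr>) v (quantify1 rs \<psi>))"
  using assms
proof (induction rs arbitrary: ps D)
  case Nil
  have "holds (M\<lparr>dom := D\<rparr>) v \<psi> = holds M v \<psi>" for v
    by (intro holds_qfree_cong[OF qfree] atom_val_dom_update)
  then show ?case using Nil by auto
next
  case (Cons q rs)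
  have qs': "qs = (ps @ [q]) @ rs" using Cons.prems(1) by simp
  consider x where "q = (True, x)" | x where "q = (False, x)" by (cases q) auto
  then show ?case
  proof cases
    case (1 x)
    have x: "(False, x) \<notin> set ps" using distinct_qs Cons.prems(1) by (force simp: 1)
    from Cons.IH[OF qs' Cons.prems(2-4)]
    obtain D' where D': "D \<subseteq> D'" "D' \<subseteq> dom M" "finite D'"
      "card D' \<le> (growth c ^^ length rs) (card D)"
      and h': "\<forall>v. (\<forall>z. (False, z) \<in> set (ps @ [q]) \<longrightarrow> v z \<in> D) \<longrightarrow> holds M v (quantify1 rs \<psi>) \<longrightarrow>
         holds (M\<lparr>dom := D'\<rparr>) v (quantify1 rs \<psi>)"
      by blast
    have "holds (M\<lparr>dom := D'\<rparr>) v (quantify1 (q # rs) \<psi>)"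
      if v: "\<forall>z. (False, z) \<in> set ps \<longrightarrow> v z \<in> D" and h: "holds M v (quantify1 (q # rs) \<psi>)" for v
    proof -
      have "holds (M\<lparr>dom := D'\<rparr>) (v(x := u)) (quantify1 rs \<psi>)" if "u \<in> D'" for u
        using v h x that D'(2) by (intro h'[rule_format]) (auto simp: 1)
      then show ?thesis by (simp add: 1)
    qed
    \<comment> \<open>A universal quantifier adds no element; the bound can count it all the same,
      because \<open>growth\<close> is inflationary.\<close>
    moreover have "card D' \<le> (growth c ^^ length (q # rs)) (card D)"
      using D'(4) growth_ge[of "(growth c ^^ length rs) (card D)" c] by simp
    ultimately show ?thesis using D' by blast
  next
    case (2 x)
    obtain D1 where D1: "D \<subseteq> D1" "D1 \<subseteq> dom M" "finite D1" "card D1 \<le> growth c (card D)"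
      "\<forall>v. (\<forall>z. (False, z) \<in> set ps \<longrightarrow> v z \<in> D) \<longrightarrow> holds M v (quantify1 ((False, x) # rs) \<psi>) \<longrightarrow>
         (\<exists>w\<in>D1. holds M (v(x := w)) (quantify1 rs \<psi>))"
      using witnesses[OF Cons.prems[unfolded 2]] by blast
    have "D1 \<noteq> {}" using D1(1) Cons.prems(4) by blast
    from Cons.IH[OF qs' D1(3,2) this]
    obtain D' where D': "D1 \<subseteq> D'" "D' \<subseteq> dom M" "finite D'"
      "card D' \<le> (growth c ^^ length rs) (card D1)"
      and h': "\<forall>v. (\<forall>z. (False, z) \<in> set (ps @ [q]) \<longrightarrow> v z \<in> D1) \<longrightarrow> holds M v (quantify1 rs \<psi>) \<longrightarrow>
         holds (M\<lparr>dom := D'\<rparr>) v (quantify1 rs \<psi>)"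
      by blast
    have "holds (M\<lparr>dom := D'\<rparr>) v (quantify1 (q # rs) \<psi>)"
      if v: "\<forall>z. (False, z) \<in> set ps \<longrightarrow> v z \<in> D" and h: "holds M v (quantify1 (q # rs) \<psi>)" for v
    proof -
      obtain w where w: "w \<in> D1" "holds M (v(x := w)) (quantify1 rs \<psi>)"
        using D1(5) v h unfolding 2 by blast
      then have "holds (M\<lparr>dom := D'\<rparr>) (v(x := w)) (quantify1 rs \<psi>)"
        using v D1(1) by (intro h'[rule_format]) (auto simp: 2)
      then show ?thesis using w D'(1) by (auto simp: 2)
    qed
    moreover have "card D' \<le> (growth c ^^ length (q # rs)) (card D)"
      using D'(4) growth_funpow_mono[OF D1(4) order_refl, of "length rs" c]
      by (simp add: funpow_swap1)
    ultimately show ?thesis using D' D1(1) by blast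
  qed
qed

end

section \<open>Completeness of the search\<close>

definition linearize :: "prefix \<Rightarrow> (bool \<times> nat) list" where
  "linearize bs = concat (map (\<lambda>(xs, ys). map (Pair True) xs @ map (Pair False) ys) bs)"

lemma quantify_linearize: "quantify bs \<psi> = quantify1 (linearize bs) \<psi>"
proof -
  have "foldr All xs \<phi> = quantify1 (map (Pair True) xs) \<phi>"
    "foldr Ex xs \<phi> = quantify1 (map (Pair False) xs) \<phi>" for xs \<phi>
    by (induction xs) auto
  moreover have "quantify1 (qs @ rs) \<phi> = quantify1 qs (quantify1 rs \<phi>)" for qs rs \<phi>
    by (simp add: quantify1_def)
  ultimately show ?thesis
    by (induction bs) (auto simp: quantify_def linearize_def)
qed

lemma map_snd_linearize: "map snd (linearize bs) = concat (map (\<lambda>(xs, ys). xs @ ys) bs)"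
  by (induction bs) (auto simp: linearize_def comp_def)

lemma in_linearize_iff:
  "(True, x) \<in> set (linearize bs) \<longleftrightarrow> x \<in> univ_vars bs"
  "(False, x) \<in> set (linearize bs) \<longleftrightarrow> x \<in> ex_vars bs"
  by (induction bs) (auto simp: linearize_def univ_vars_def ex_vars_def)

lemma linearize_append: "linearize (bs @ bs') = linearize bs @ linearize bs'"
  by (simp add: linearize_def)

lemma quantify1_Cons:
  "quantify1 (q # qs) \<psi> = (if fst q then All else Ex) (snd q) (quantify1 qs \<psi>)"
  by (simp add: quantify1_def split_beta)

lemma atoms_quantify1: "atoms (quantify1 qs \<psi>) = atoms \<psi>"
  by (induction qs) (simp_all add: quantify1_Cons)

lemma free_vars_quantify1: "free_vars (quantify1 qs \<psi>) = free_vars \<psi> - snd ` set qs"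
  by (induction qs) (auto simp: quantify1_Cons)

lemma free_vars_qfree: "qfree \<psi> \<Longrightarrow> free_vars \<psi> = vars (atoms \<psi>)"
  by (induction \<psi>) (auto simp: vars_def)

lemma qfree_nnf_matrix: "nnf_matrix \<psi> \<Longrightarrow> qfree \<psi>"
  by (induction \<psi> rule: nnf_matrix.induct) auto

lemma gbsr_function_free: "gbsr \<phi> \<Longrightarrow> function_free \<phi>"
  unfolding gbsr_def function_free_def by blast

lemma gbsr_sentence: "gbsr \<phi> \<Longrightarrow> sentence \<phi>"
  unfolding gbsr_def standard_form_def by blast

text \<open>The existential variables of part \<open>i\<close> stand in the first \<open>i\<close>
  blocks and its universal ones in the later blocks, which gives the order condition for single
  quantifiers.\<close>

lemma gbsr_separated_prefix:
  assumes "gbsr \<phi>"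
  obtains qs \<psi> cl where "\<phi> = quantify1 qs \<psi>" "separated_prefix qs \<psi> cl (fm_code \<phi>)"
proof -
  obtain bs \<psi> and At :: "nat \<Rightarrow> atom set" where sf: "standard_form bs \<psi> \<phi>"
    and At: "(\<Union>i\<le>length bs. At i) = atoms \<phi>"
    and At_vars: "\<forall>i\<le>length bs. vars (At i) \<subseteq> ex_vars (take i bs) \<union> univ_vars (drop i bs)"
    and At_sep: "\<forall>i j. i < j \<and> j \<le> length bs \<longrightarrow> vars (At i) \<inter> vars (At j) \<inter> univ_vars bs = {}"
    using assms unfolding gbsr_def by (elim exE conjE) (rule that)
  define qs where "qs = linearize bs"
  have \<phi>: "\<phi> = quantify1 qs \<psi>"
    using sf by (simp add: standard_form_def quantify_linearize qs_def)
  have qf: "qfree \<psi>" using sf by (simp add: standard_form_def qfree_nnf_matrix)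
  have dist: "distinct (map snd qs)"
    using sf by (simp add: standard_form_def map_snd_linearize qs_def)
  have at: "atoms \<phi> = atoms \<psi>" by (simp add: \<phi> atoms_quantify1)
  define cl where "cl a = (SOME i. i \<le> length bs \<and> a \<in> At i)" for a
  have cl: "cl a \<le> length bs \<and> a \<in> At (cl a)" if "a \<in> atoms \<psi>" for a
    unfolding cl_def by (rule someI_ex) (use that At at in blast)
  have part: "i \<le> length bs \<and> x \<in> vars (At i)" if "x \<in> vars {a\<in>atoms \<psi>. cl a = i}" for x i
    using that cl unfolding vars_def by blast
  have disj: "\<not> ((True, x) \<in> set qs \<and> (False, x) \<in> set qs)" for x
    using dist inj_onD[of snd "set qs" "(True, x)" "(False, x)"] by (auto simp: distinct_map)
  have qs_sub: "snd ` set qs = univ_vars bs \<union> ex_vars bs"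
    unfolding qs_def set_map[symmetric] map_snd_linearize univ_vars_def ex_vars_def by auto
  have "separated_prefix qs \<psi> cl (fm_code \<phi>)"
  proof
    show "qfree \<psi>" by fact
    show "distinct (map snd qs)" by fact
    show "vars (atoms \<psi>) \<subseteq> snd ` set qs"
      using gbsr_sentence[OF assms] free_vars_qfree[OF qf]
      by (auto simp: sentence_def \<phi> free_vars_quantify1)
    show "atom_code a \<le> fm_code \<phi>" if "a \<in> atoms \<psi>" for a
      using that at atom_code_le_fm_code by blast
    show "x \<le> fm_code \<phi>" if "x \<in> snd ` set qs" for x
      using var_le_fm_code[OF gbsr_function_free[OF assms]] that sf qs_sub at
      by (auto simp: standard_form_def)
    show "i = j" if x: "(True, x) \<in> set qs" and i: "x \<in> vars {a\<in>atoms \<psi>. cl a = i}"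
      and j: "x \<in> vars {a\<in>atoms \<psi>. cl a = j}" for x i j
    proof (rule ccontr)
      assume "i \<noteq> j"
      moreover have "x \<in> univ_vars bs" using x by (simp add: qs_def in_linearize_iff)
      ultimately show False
        using part[OF i] part[OF j] At_sep by (cases i j rule: linorder_cases) blast+
    qed
    show "x \<notin> vars {a\<in>atoms \<psi>. cl a = i}"
      if ps: "qs = ps @ (False, y) # rs" and y: "y \<in> vars {a\<in>atoms \<psi>. cl a = i}"
        and x: "(True, x) \<in> set ps" for ps rs y x i
    proof
      assume x': "x \<in> vars {a\<in>atoms \<psi>. cl a = i}"
      \<comment> \<open>The cut after \<open>i\<close> blocks: \<open>y\<close> must lie to its left
        and \<open>x\<close> to its right, although \<open>x\<close> precedes
        \<open>y\<close>.\<close>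
      let ?L = "linearize (take i bs)" and ?R = "linearize (drop i bs)"
      have LR: "qs = ?L @ ?R" by (simp add: qs_def flip: linearize_append)
      have in_qs: "(True, x) \<in> set qs" "(False, y) \<in> set qs" using ps x by auto
      have "(True, x) \<in> set ?R \<or> (False, x) \<in> set ?L" "(False, y) \<in> set ?L \<or> (True, y) \<in> set ?R"
        using part[OF x'] part[OF y] At_vars unfolding in_linearize_iff by blast+
      moreover have "set ?L \<subseteq> set qs" "set ?R \<subseteq> set qs" by (auto simp: LR)
      ultimately have mem: "(True, x) \<in> set ?R" "(False, y) \<in> set ?L" using disj in_qs by blast+
      have "distinct qs" using dist distinct_map by blast
      then have disj_LR: "set ?L \<inter> set ?R = {}" unfolding LR by simp
      have "ps @ (False, y) # rs = ?L @ ?R" using ps LR by simp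
      \<comment> \<open>Either this occurrence of \<open>y\<close> is right of the cut, or all of
        \<open>ps\<close>, including \<open>x\<close>, is left of it.\<close>
      then obtain us where "us @ (False, y) # rs = ?R \<or> ps @ us = ?L"
        unfolding append_eq_append_conv2 by blast
      then have "(False, y) \<in> set ?R \<or> (True, x) \<in> set ?L"
        using x by (metis Un_iff list.set_intros(1) set_append)
      then show False using mem disj_LR by blast
    qed
  qed
  with \<phi> show ?thesis using that by blast
qed

text \<open>The element type is arbitrary because the finite domain is renumbered as
  \<open>{..<n}\<close>, with constants and predicates tabulated in \<open>K\<close> and
  \<open>R\<close>.\<close>

lemma has_small_model_of_models:
  fixes M :: "'u struct"
  assumes gbsr: "gbsr \<phi>" and mod: "models M \<phi>"
  shows "has_small_model (fm_code \<phi>)"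
proof -
  define c where "c = fm_code \<phi>"
  define N where "N = size_bound c"
  obtain qs \<psi> cl where \<phi>: "\<phi> = quantify1 qs \<psi>" and sep: "separated_prefix qs \<psi> cl c"
    using gbsr_separated_prefix[OF gbsr] unfolding c_def by blast
  interpret separated_prefix qs \<psi> cl M c by (rule sep)
  have str: "is_struct M" using mod by (simp add: models_def)
  then obtain d0 where d0: "d0 \<in> dom M" by (auto simp: is_struct_def)
  \<comment> \<open>\<open>d0\<close> supplies a default assignment; constant names above
    \<open>c\<close> do not occur in \<open>\<phi>\<close>.\<close>
  define D0 where "D0 = insert d0 ((\<lambda>f. fint M f []) ` {..c})"
  have D0: "finite D0" "D0 \<subseteq> dom M" "D0 \<noteq> {}"
    using str d0 by (auto simp: D0_def is_struct_def)
  have "card D0 \<le> Suc (card ((\<lambda>f. fint M f []) ` {..c}))"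
    unfolding D0_def by (rule card_insert_le_m1) simp_all
  also have "\<dots> \<le> Suc (Suc c)" using card_image_le[of "{..c}" "\<lambda>f. fint M f []"] by simp
  finally have card_D0: "card D0 \<le> Suc (Suc c)" .
  have hM: "holds M (\<lambda>_. d0) (quantify1 qs \<psi>)" using mod d0 by (auto simp: models_def \<phi>)
  from small_domain[of "[]" qs, OF _ D0] obtain D where D: "D0 \<subseteq> D" "finite D"
    "card D \<le> (growth c ^^ length qs) (card D0)"
    and hD: "\<forall>v. (\<forall>z. (False, z) \<in> set [] \<longrightarrow> v z \<in> D0) \<longrightarrow> holds M v (quantify1 qs \<psi>) \<longrightarrow>
      holds (M\<lparr>dom := D\<rparr>) v (quantify1 qs \<psi>)"
    by auto
  have holds_D: "holds (M\<lparr>dom := D\<rparr>) (\<lambda>_. d0) \<phi>" using hD hM \<phi> by simp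
  define n where "n = card D"
  have n: "0 < n" using D(1,2) by (auto simp: n_def card_gt_0_iff D0_def)
  have "n \<le> N"
    unfolding n_def N_def size_bound_def
    using D(3) growth_funpow_mono[OF card_D0 length_qs_le] by (rule order_trans)
  obtain h where h: "bij_betw h D {..<n}"
    using ex_bij_betw_finite_nat[OF D(2)] by (auto simp: n_def atLeast0LessThan)
  have h_less: "h d < n" if "d \<in> D" for d using h that by (auto simp: bij_betw_def)
  have inv: "inv_into D h (h d) = d" if "d \<in> D" for d
    using h that by (simp add: bij_betw_def)
  have const: "fint M f [] \<in> D" if "f \<le> c" for f using that D(1) by (auto simp: D0_def)
  obtain K where K: "K < n ^ Suc c" "\<And>f. f \<le> c \<Longrightarrow> digit n K f = h (fint M f [])"
    using ex_digits[of "Suc c" "\<lambda>f. h (fint M f [])" n] const h_less by (auto simp: less_Suc_eq_le)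
  define B where "B = Suc (prod_encode (c, list_bound N c))"
  \<comment> \<open>The truncation to names and lengths up to \<open>c\<close> keeps
    \<open>R\<close> bounded and loses no atom of \<open>\<phi>\<close>.\<close>
  define T where "T = {prod_encode (p, list_encode us) | p us. p \<le> c \<and> length us \<le> c \<and>
    set us \<subseteq> {..<n} \<and> pint M p (map (inv_into D h) us)}"
  have "prod_encode (p, list_encode us) < B" if "p \<le> c" "length us \<le> c" "set us \<subseteq> {..<n}" for p us
  proof -
    have "set us \<subseteq> {..N}" using that(3) \<open>n \<le> N\<close> by auto
    then show ?thesis unfolding B_def less_Suc_eq_le
      using that by (intro prod_encode_mono list_encode_le_list_bound)
  qed
  then have T: "T \<subseteq> {..<B}" unfolding T_def by auto
  define R where "R = set_encode T"
  have R: "R < 2 ^ B" "set_decode R = T"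
    using set_encode_less[OF T] finite_subset[OF T] by (simp_all add: R_def)
  define S where "S = struct_of n K R"
  have term_eq: "tm_val S (h \<circ> v) t = h (tm_val M v t)" "tm_val M v t \<in> D"
    if "var_or_const t" "range v \<subseteq> D" "\<And>f ts. t = Fun f ts \<Longrightarrow> f \<le> c" for v t
    using that K(2) const by (cases t; auto simp: S_def struct_of_def)+
  have atom_eq: "atom_val M v a = atom_val S (h \<circ> v) a"
    if a: "a \<in> atoms \<phi>" and v: "range v \<subseteq> D" for a v
  proof -
    have ac: "atom_code a \<le> c" using a atom_code_le_fm_code by (simp add: c_def)
    have ts: "tm_val S (h \<circ> v) t = h (tm_val M v t)" "tm_val M v t \<in> D" if "t \<in> atom_tms a" for t
    proof -
      have t: "var_or_const t" using gbsr_function_free[OF gbsr] a that by (simp add: function_free_def)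
      have f: "f \<le> c" if "t = Fun f ts" for f ts
        using const_le_atom_code[of f ts a] ac that \<open>t \<in> atom_tms a\<close> by simp
      show "tm_val S (h \<circ> v) t = h (tm_val M v t)" by (rule term_eq(1)[OF t v f])
      show "tm_val M v t \<in> D" by (rule term_eq(2)[OF t v f])
    qed
    show ?thesis
    proof (cases a)
      case (Pred p ts)
      define us where "us = map (tm_val S (h \<circ> v)) ts"
      have us: "us = map (\<lambda>t. h (tm_val M v t)) ts" using ts(1) Pred by (simp add: us_def)
      have inv_us: "map (inv_into D h) us = map (tm_val M v) ts"
        using ts(2) Pred inv by (simp add: us)
      have "p \<le> c" "length us \<le> c"
        using pred_code_le(1)[of p ts] pred_code_le(2)[of ts p] ac Pred by (auto simp: us_def)
      moreover have "set us \<subseteq> {..<n}" using ts(2) Pred h_less by (auto simp: us)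
      ultimately have "prod_encode (p, list_encode us) \<in> T \<longleftrightarrow> pint M p (map (inv_into D h) us)"
        unfolding T_def by (auto simp: list_encode_eq)
      then show ?thesis
        unfolding inv_us using R(2) by (simp add: Pred us_def S_def struct_of_def)
    next
      case (Eq s t)
      have "h (tm_val M v s) = h (tm_val M v t) \<longleftrightarrow> tm_val M v s = tm_val M v t"
        using ts(2) Eq inv by (metis atom_tms.simps(2) insertCI)
      then show ?thesis using ts(1) Eq by simp
    qed
  qed
  \<comment> \<open>Outside the atoms of \<open>\<phi>\<close> the structures may differ, hence the
    condition on \<open>p\<close>. Quantifiers transfer since \<open>h\<close> maps \<open>D\<close>
    onto the domain of \<open>S\<close>.\<close>
  have holds_eq: "holds (M\<lparr>dom := D\<rparr>) v p = holds S (h \<circ> v) p"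
    if "atoms p \<subseteq> atoms \<phi>" "range v \<subseteq> D" for v p
    using that
  proof (induction p arbitrary: v)
    case (All x p)
    have "holds (M\<lparr>dom := D\<rparr>) (v(x := u)) p = holds S ((h \<circ> v)(x := h u)) p" if "u \<in> D" for u
    proof -
      have "range (v(x := u)) \<subseteq> D" using All.prems(2) that by auto
      then show ?thesis using All.IH[of "v(x := u)"] All.prems(1) by (simp only: fun_upd_comp atoms.simps)
    qed
    moreover have "dom S = h ` D" using h by (simp add: S_def struct_of_def bij_betw_def)
    ultimately show ?case by (simp add: comp_def)
  next
    case (Ex x p)
    have "holds (M\<lparr>dom := D\<rparr>) (v(x := u)) p = holds S ((h \<circ> v)(x := h u)) p" if "u \<in> D" for u
    proof -
      have "range (v(x := u)) \<subseteq> D" using Ex.prems(2) that by auto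
      then show ?thesis using Ex.IH[of "v(x := u)"] Ex.prems(1) by (simp only: fun_upd_comp atoms.simps)
    qed
    moreover have "dom S = h ` D" using h by (simp add: S_def struct_of_def bij_betw_def)
    ultimately show ?case by (simp add: comp_def)
  qed (simp_all add: atom_val_dom_update atom_eq)
  have "d0 \<in> D" using D(1) by (simp add: D0_def)
  then have "holds S (h \<circ> (\<lambda>_. d0)) \<phi>" using holds_eq[of \<phi> "\<lambda>_. d0"] holds_D by auto
  then have "holds S (digit n 0) \<phi>"
    using holds_cong[of \<phi> "h \<circ> (\<lambda>_. d0)" "digit n 0"] gbsr_sentence[OF gbsr] by (simp add: sentence_def)
  then show ?thesis
    unfolding c_def[symmetric] has_small_model_iff[OF gbsr_function_free[OF gbsr] c_def]
    using n \<open>n \<le> N\<close> K(1) R(1) unfolding S_def N_def B_def by blast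
qed

theorem theorem1:
  "\<exists>f. \<forall>\<phi>. gbsr \<phi> \<longrightarrow>
     (rec_eval f [fm_code \<phi>] 1 \<and> has_model TYPE(nat) \<phi>) \<or>
     (rec_eval f [fm_code \<phi>] 0 \<and> \<not> has_model TYPE(nat) \<phi> \<and> \<not> has_model TYPE('u) \<phi>)"
proof -
  obtain f where "\<And>v. rec_eval f (map v [0..<1]) (of_bool (has_small_model (v 0)))"
    using decidable_has_small_model unfolding computable_def by blast
  from this[of "\<lambda>_. c" for c]
  have f: "rec_eval f [c] (of_bool (has_small_model c))" for c by simp
  have "(rec_eval f [fm_code \<phi>] 1 \<and> has_model TYPE(nat) \<phi>) \<or>
     (rec_eval f [fm_code \<phi>] 0 \<and> \<not> has_model TYPE(nat) \<phi> \<and> \<not> has_model TYPE('u) \<phi>)"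
    if "gbsr \<phi>" for \<phi>
  proof (cases "has_small_model (fm_code \<phi>)")
    case True
    then show ?thesis
      using f[of "fm_code \<phi>"] has_model_of_has_small_model gbsr_function_free[OF that] gbsr_sentence[OF that]
      by simp
  next
    case False
    \<comment> \<open>Completeness of the search is polymorphic in the element type, so one failed
      test excludes models over \<open>nat\<close> and over \<open>'u\<close>.\<close>
    have "\<not> models M \<phi>" for M :: "nat struct" using False has_small_model_of_models[OF that] by blast
    moreover have "\<not> models M \<phi>" for M :: "'u struct"
      using False has_small_model_of_models[OF that] by blast
    ultimately show ?thesis
      using f[of "fm_code \<phi>"] False by (simp add: has_model_def)
  qed
  then show ?thesis by blast
qed

end
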